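(* Let $\Sigma$ be an $(n-1)$-dimensional isotropic submanifold of $\mathbb{C}^n$, let $B\in GL(n,\mathbb{C})$ and $b\in\mathbb{C}^n$, and suppose $(\Sigma,B,b)$ is an initial data with constant Lagrangian angle. Let $I\subset\mathbb{R}$ be an interval containing $0$ and let $(A(s),a(s))$, with $A(s)\in GL(n,\mathbb{C})$ and $a(s)\in\mathbb{C}^n$ for $s\in I$, be a solution of $$A^*(s)\dot A(s)=\overline{\det A(s)}\,B,\qquad A^*(s)\dot a(s)=\overline{\det A(s)}\,b,\qquad A(0)=\mathrm{Id},\qquad a(0)=0,$$ where $A^*$ is the conjugate transpose of $A$ and the dot denotes $d/ds$. Then $A(s)\Sigma+a(s)$, that is, the submanifold of $\mathbb{C}^n$ parametrized by $$F: I\times\Sigma\to\mathbb{C}^n,\qquad F(s,p)=A(s)X_p+a(s),$$ is a special Lagrangian submanifold.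
   Context: $\mathbb{C}^n$ carries its standard Hermitian product $\langle\cdot,\cdot\rangle$ and standard Kähler form $\omega$ (up to sign, $\omega$ is the imaginary part of $\langle\cdot,\cdot\rangle$). For a submanifold $\Sigma$ and $p\in\Sigma$, $X_p\in\mathbb{C}^n$ denotes the position vector of $p$. A submanifold is isotropic if $\omega$ restricts to zero on it, and Lagrangian if it is isotropic of real dimension $n$. Submanifolds parametrized by a map $F$ are understood as immersed, not necessarily embedded. The Lagrangian angle of a Lagrangian subspace $P\subset\mathbb{C}^n$ with real basis $e_1,\dots,e_n$ is $\arg\det_{\mathbb{C}}(e_1,\dots,e_n)$, which is well defined modulo $\pi$ for unoriented $P$ (modulo $2\pi$ if $P$ is oriented). An (immersed) Lagrangian submanifold is special Lagrangian if the Lagrangian angle of its tangent spaces is constant. An isotropic submanifold $\Sigma$ of $\mathbb{C}^n$ is called an initial data with respect to $(B,b)$, with $B\in GL(n,\mathbb{C})$ and $b\in\mathbb{C}^n$, if at every point $p\in\Sigma$ one has $\langle V, BX_p+b\rangle=0$ for all $V\in T_p\Sigma$ (vanishing of the full complex-valued Hermitian product). For $\Sigma$ of dimension $n-1$, $(\Sigma,B,b)$ is an initial data with constant Lagrangian angle if it is an initial data and the Lagrangian angle of the Lagrangian subspace $T_p\Sigma\oplus\mathbb{R}(BX_p+b)$ is constant in $p\in\Sigma$ (in particular $BX_p+b\neq0$ for all $p\in\Sigma$). *)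

theory Defs
  imports "HOL-Analysis.Analysis"
begin

section \<open>Smooth maps on subsets of a normed space\<close>

text \<open>The domain \<open>U\<close> need not be open. On the sets used below (relatively open subsets of a linear
  subspace \<open>V\<close>, or of a half-space in \<open>V\<close>) the derivative within \<open>U\<close> is uniquely determined on \<open>V\<close>
  and irrelevant outside \<open>V\<close>, so this is the usual \<open>C\<^sup>k\<close> notion, one-sided at boundary points.\<close>

primrec Ck_on :: "nat \<Rightarrow> 'a::real_normed_vector set \<Rightarrow> ('a \<Rightarrow> 'b::real_normed_vector) \<Rightarrow> bool" where
  "Ck_on 0 U f \<longleftrightarrow> continuous_on U f"
| "Ck_on (Suc k) U f \<longleftrightarrow>
     (\<exists>f'. (\<forall>x\<in>U. (f has_derivative f' x) (at x within U)) \<and> (\<forall>v. Ck_on k U (\<lambda>x. f' x v)))"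

definition smooth_on :: "'a::real_normed_vector set \<Rightarrow> ('a \<Rightarrow> 'b::real_normed_vector) \<Rightarrow> bool" where
  "smooth_on U f \<longleftrightarrow> (\<forall>k. Ck_on k U f)"


section \<open>Immersed submanifolds of a Euclidean space\<close>

text \<open>An immersed submanifold is a topological space \<open>M\<close> of points together with a position map
  \<open>X\<close>, which need not be injective. No atlas is carried along: two homeomorphic parametrizations of
  open pieces of \<open>M\<close> that both turn \<open>X\<close> into a smooth immersion have smooth transition maps, so the
  topology and \<open>X\<close> determine the smooth structure. An embedded submanifold \<open>S\<close> is the case
  \<open>M = top_of_set S\<close>, \<open>X = id\<close>.

  The parameter domain lies in a \<open>k\<close>-dimensional linear subspace \<open>V\<close> standing for \<open>\<real>\<^sup>k\<close>; this
  includes \<open>k = 0\<close>, which no type of class \<open>euclidean_space\<close> can model. It is open in \<open>V\<close> or in a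
  closed half-space of \<open>V\<close> (boundary chart); \<open>v = 0\<close>, \<open>c = 0\<close> gives all of \<open>V\<close>.\<close>

definition local_param ::
    "nat \<Rightarrow> 'p topology \<Rightarrow> ('p \<Rightarrow> 'e::euclidean_space) \<Rightarrow> 'e set \<Rightarrow> 'e set \<Rightarrow> ('e \<Rightarrow> 'p) \<Rightarrow> bool" where
  "local_param k M X V U \<phi> \<longleftrightarrow>
     subspace V \<and> dim V = k \<and>
     (\<exists>v c. openin (top_of_set (V \<inter> {x. c \<le> v \<bullet> x})) U) \<and>
     openin M (\<phi> ` U) \<and>
     homeomorphic_map (top_of_set U) (subtopology M (\<phi> ` U)) \<phi> \<and>
     smooth_on U (X \<circ> \<phi>) \<and>
     (\<forall>u\<in>U. \<forall>D. ((X \<circ> \<phi>) has_derivative D) (at u within U) \<longrightarrow> inj_on D V)"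

definition immersed_submanifold_with_boundary ::
    "nat \<Rightarrow> 'p topology \<Rightarrow> ('p \<Rightarrow> 'e::euclidean_space) \<Rightarrow> bool" where
  "immersed_submanifold_with_boundary k M X \<longleftrightarrow>
     Hausdorff_space M \<and> second_countable M \<and>
     (\<forall>p\<in>topspace M. \<exists>V U \<phi>. local_param k M X V U \<phi> \<and> p \<in> \<phi> ` U)"

definition immersed_submanifold ::
    "nat \<Rightarrow> 'p topology \<Rightarrow> ('p \<Rightarrow> 'e::euclidean_space) \<Rightarrow> bool" where
  "immersed_submanifold k M X \<longleftrightarrow>
     Hausdorff_space M \<and> second_countable M \<and>
     (\<forall>p\<in>topspace M. \<exists>V U \<phi>. local_param k M X V U \<phi> \<and> openin (top_of_set V) U \<and> p \<in> \<phi> ` U)"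

text \<open>The image of \<open>T\<^sub>pM\<close> under \<open>dX\<close>; every parametrization around \<open>p\<close> yields the same subspace.\<close>

definition tangent_space ::
    "nat \<Rightarrow> 'p topology \<Rightarrow> ('p \<Rightarrow> 'e::euclidean_space) \<Rightarrow> 'p \<Rightarrow> 'e set" where
  "tangent_space k M X p =
     {D v | D v. \<exists>V U \<phi> u. local_param k M X V U \<phi> \<and> u \<in> U \<and> \<phi> u = p \<and>
        ((X \<circ> \<phi>) has_derivative D) (at u within U) \<and> v \<in> V}"


section \<open>Hermitian and symplectic structure of \<open>\<complex>\<^sup>n\<close>\<close>

definition herm :: "complex ^ 'n \<Rightarrow> complex ^ 'n \<Rightarrow> complex" where
  "herm v w = (\<Sum>i\<in>UNIV. v $ i * cnj (w $ i))"

definition kaehler_form :: "complex ^ 'n \<Rightarrow> complex ^ 'n \<Rightarrow> real" where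
  "kaehler_form v w = - Im (herm v w)"

definition conj_transpose :: "complex ^ 'n ^ 'm \<Rightarrow> complex ^ 'm ^ 'n" where
  "conj_transpose A = (\<chi> i j. cnj (A $ j $ i))"

text \<open>The angle modulo \<open>\<pi>\<close> is represented by its coset in \<open>\<real>/\<pi>\<int>\<close>. Independence and span are over
  \<open>\<real>\<close>; the columns of the matrix are the basis vectors.\<close>

definition lagrangian_angle :: "(complex ^ 'n) set \<Rightarrow> real set" where
  "lagrangian_angle P =
     {Arg (det (\<chi> i j. e j $ i)) + of_int m * pi | (e :: 'n \<Rightarrow> complex ^ 'n) (m :: int).
        inj e \<and> independent (range e) \<and> span (range e) = P}"


section \<open>Isotropic, Lagrangian and special Lagrangian submanifolds, initial data\<close>

definition isotropic :: "nat \<Rightarrow> 'p topology \<Rightarrow> ('p \<Rightarrow> complex ^ 'n) \<Rightarrow> bool" where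
  "isotropic k M X \<longleftrightarrow>
     (\<forall>p\<in>topspace M. \<forall>v\<in>tangent_space k M X p. \<forall>w\<in>tangent_space k M X p. kaehler_form v w = 0)"

definition lagrangian :: "'p topology \<Rightarrow> ('p \<Rightarrow> complex ^ 'n) \<Rightarrow> bool" where
  "lagrangian M X \<longleftrightarrow>
     immersed_submanifold_with_boundary CARD('n) M X \<and> isotropic CARD('n) M X"

definition special_lagrangian :: "'p topology \<Rightarrow> ('p \<Rightarrow> complex ^ 'n) \<Rightarrow> bool" where
  "special_lagrangian M X \<longleftrightarrow>
     lagrangian M X \<and>
     (\<exists>\<Theta>. \<forall>p\<in>topspace M. lagrangian_angle (tangent_space CARD('n) M X p) = \<Theta>)"

definition initial_data ::
    "nat \<Rightarrow> 'p topology \<Rightarrow> ('p \<Rightarrow> complex ^ 'n) \<Rightarrow> complex ^ 'n ^ 'n \<Rightarrow> complex ^ 'n \<Rightarrow> bool" where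
  "initial_data k M X B b \<longleftrightarrow>
     immersed_submanifold k M X \<and> isotropic k M X \<and> invertible B \<and>
     (\<forall>p\<in>topspace M. \<forall>v\<in>tangent_space k M X p. herm v (B *v X p + b) = 0)"

definition initial_data_const_angle ::
    "'p topology \<Rightarrow> ('p \<Rightarrow> complex ^ 'n) \<Rightarrow> complex ^ 'n ^ 'n \<Rightarrow> complex ^ 'n \<Rightarrow> bool" where
  "initial_data_const_angle M X B b \<longleftrightarrow>
     initial_data (CARD('n) - 1) M X B b \<and>
     (\<forall>p\<in>topspace M. B *v X p + b \<noteq> 0) \<and>
     (\<exists>\<Theta>. \<forall>p\<in>topspace M.
        lagrangian_angle {v + r *\<^sub>R (B *v X p + b) | v r. v \<in> tangent_space (CARD('n) - 1) M X p} = \<Theta>)"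

end

theory Submission
  imports Defs
begin

text \<open>The tangent space of the swept-out submanifold at \<open>(s, p)\<close> is \<open>A T \<oplus> \<real> y\<close>, where
  \<open>T = T\<^sub>p\<Sigma>\<close>, \<open>w = B X\<^sub>p + b\<close> and \<open>A\<^sup>* y = cnj (det A) w\<close>. Hence \<open>\<langle>A v, y\<rangle> = det A \<langle>v, w\<rangle> = 0\<close> for
  \<open>v \<in> T\<close>. Differentiating \<open>\<langle>v, B X + b\<rangle> = 0\<close> along \<open>\<Sigma>\<close> and using the symmetry of second derivatives
  gives \<open>\<langle>v, B v'\<rangle> = \<langle>v', B v\<rangle>\<close>; therefore \<open>d/ds \<langle>A v, A v'\<rangle>\<close> is a number plus its conjugate, and
  \<open>A T\<close> stays isotropic. Finally \<open>\<parallel>A v\<parallel>\<^sup>2 = 0\<close> whenever \<open>A v\<close> is a multiple of \<open>y\<close>, so the map is an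
  immersion, and the complex determinant of \<open>A T \<oplus> \<real> y\<close> is \<open>\<parallel>y\<parallel>\<^sup>2 / \<parallel>w\<parallel>\<^sup>2\<close> times that of
  \<open>T \<oplus> \<real> w\<close>, so the Lagrangian angle does not change.\<close>

section \<open>Calculus of \<open>C\<^sup>k\<close> maps\<close>

lemma Ck_on_cong:
  assumes "Ck_on k U f" "\<And>x. x \<in> U \<Longrightarrow> f x = g x"
  shows "Ck_on k U g"
proof (cases k)
  case 0
  then show ?thesis using assms continuous_on_cong[of U U f g] by simp
next
  case (Suc m)
  then obtain f' where f': "\<forall>x\<in>U. (f has_derivative f' x) (at x within U)"
    "\<forall>v. Ck_on m U (\<lambda>x. f' x v)"
    using assms(1) by auto
  have "\<forall>x\<in>U. (g has_derivative f' x) (at x within U)"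
    using f'(1) assms(2) by (metis has_derivative_transform)
  then show ?thesis using f'(2) Suc by auto
qed

lemma Ck_on_Suc_imp: "Ck_on (Suc k) U f \<Longrightarrow> Ck_on k U f"
proof (induction k arbitrary: f)
  case 0
  then show ?case
    by (auto simp: continuous_on_eq_continuous_within intro: has_derivative_continuous)
next
  case (Suc k)
  then obtain f' where f': "\<forall>x\<in>U. (f has_derivative f' x) (at x within U)"
    "\<forall>v. Ck_on (Suc k) U (\<lambda>x. f' x v)"
    by (metis Ck_on.simps(2))
  then have "\<forall>v. Ck_on k U (\<lambda>x. f' x v)" using Suc.IH by blast
  with f'(1) show ?case by auto
qed

lemma Ck_on_const: "Ck_on k U (\<lambda>x. c)"
proof (induction k arbitrary: c)
  case (Suc k)
  show ?case
    using Suc[of 0] by (auto intro!: exI[of _ "\<lambda>x v. 0"])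
qed simp

lemma Ck_on_bounded_linear:
  assumes "bounded_linear h"
  shows "Ck_on k U f \<Longrightarrow> Ck_on k U (\<lambda>x. h (f x))"
proof (induction k arbitrary: f)
  case 0
  then show ?case by (simp add: bounded_linear.continuous_on[OF assms])
next
  case (Suc k)
  then obtain f' where f': "\<forall>x\<in>U. (f has_derivative f' x) (at x within U)"
    "\<forall>v. Ck_on k U (\<lambda>x. f' x v)"
    by auto
  show ?case
    using f' Suc.IH
    by (auto intro!: exI[of _ "\<lambda>x v. h (f' x v)"] bounded_linear.has_derivative[OF assms])
qed

lemma Ck_on_add:
  "Ck_on k U f \<Longrightarrow> Ck_on k U g \<Longrightarrow> Ck_on k U (\<lambda>x. f x + g x)"
proof (induction k arbitrary: f g)
  case 0
  then show ?case by (simp add: continuous_on_add)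
next
  case (Suc k)
  obtain f' where f': "\<forall>x\<in>U. (f has_derivative f' x) (at x within U)"
    "\<forall>v. Ck_on k U (\<lambda>x. f' x v)"
    using Suc.prems(1) by auto
  obtain g' where g': "\<forall>x\<in>U. (g has_derivative g' x) (at x within U)"
    "\<forall>v. Ck_on k U (\<lambda>x. g' x v)"
    using Suc.prems(2) by auto
  show ?case
    using f' g' Suc.IH
    by (auto intro!: exI[of _ "\<lambda>x v. f' x v + g' x v"] has_derivative_add)
qed

text \<open>The product rule writes the derivative in terms of \<open>f\<close>, \<open>g\<close>
  and their derivatives. The induction closes because \<open>f\<close> and \<open>g\<close> are
  themselves of the lower order by \<open>Ck_on_Suc_imp\<close>.\<close>

lemma Ck_on_bounded_bilinear:
  assumes "bounded_bilinear h"
  shows "Ck_on k U f \<Longrightarrow> Ck_on k U g \<Longrightarrow> Ck_on k U (\<lambda>x. h (f x) (g x))"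
proof (induction k arbitrary: f g)
  case 0
  then show ?case by (simp add: bounded_bilinear.continuous_on[OF assms])
next
  case (Suc k)
  obtain f' where f': "\<forall>x\<in>U. (f has_derivative f' x) (at x within U)"
    "\<forall>v. Ck_on k U (\<lambda>x. f' x v)"
    using Suc.prems(1) by auto
  obtain g' where g': "\<forall>x\<in>U. (g has_derivative g' x) (at x within U)"
    "\<forall>v. Ck_on k U (\<lambda>x. g' x v)"
    using Suc.prems(2) by auto
  show ?case
    unfolding Ck_on.simps
  proof (intro exI[of _ "\<lambda>x v. h (f x) (g' x v) + h (f' x v) (g x)"] conjI ballI allI)
    show "((\<lambda>x. h (f x) (g x)) has_derivative (\<lambda>v. h (f x) (g' x v) + h (f' x v) (g x))) (at x within U)"
      if "x \<in> U" for x
      using bounded_bilinear.FDERIV[OF assms] f' g' that by blast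
    show "Ck_on k U (\<lambda>x. h (f x) (g' x v) + h (f' x v) (g x))" for v
      using Ck_on_Suc_imp[OF Suc.prems(1)] Ck_on_Suc_imp[OF Suc.prems(2)] f'(2) g'(2) Suc.IH
      by (intro Ck_on_add) auto
  qed
qed

lemma has_derivative_compose_linear:
  assumes L: "bounded_linear L" "L ` U \<subseteq> W" and f: "(f has_derivative D) (at (L x) within W)"
  shows "((\<lambda>x. f (L x)) has_derivative (\<lambda>v. D (L v))) (at x within U)"
  using diff_chain_within[OF bounded_linear_imp_has_derivative[OF L(1)] has_derivative_subset[OF f L(2)]]
  by (simp add: o_def)

text \<open>A linear inner map has constant derivative, so the chain rule produces
  \<open>f' (L x) (L v)\<close> with the fixed vector \<open>L v\<close>, to which the induction
  hypothesis applies. The coordinates of the product charts below are linear, so this case of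
  composition suffices.\<close>

lemma Ck_on_compose_linear:
  assumes L: "bounded_linear L" "L ` U \<subseteq> W"
  shows "Ck_on k W f \<Longrightarrow> Ck_on k U (\<lambda>x. f (L x))"
proof (induction k arbitrary: f)
  case 0
  then show ?case
    using continuous_on_compose2[OF _ linear_continuous_on[OF L(1)] L(2)] by auto
next
  case (Suc k)
  then obtain f' where f': "\<forall>x\<in>W. (f has_derivative f' x) (at x within W)"
    "\<forall>v. Ck_on k W (\<lambda>x. f' x v)"
    by auto
  have "((\<lambda>x. f (L x)) has_derivative (\<lambda>v. f' (L x) (L v))) (at x within U)" if "x \<in> U" for x
    using f'(1) that L(2) by (intro has_derivative_compose_linear[OF L]) auto
  moreover have "\<forall>v. Ck_on k U (\<lambda>x. f' (L x) (L v))"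
    using f'(2) Suc.IH by blast
  ultimately show ?case
    unfolding Ck_on.simps by (intro exI[of _ "\<lambda>x v. f' (L x) (L v)"]) blast
qed

section \<open>Finite sums and products, vectors and determinants\<close>

lemma Ck_on_sum:
  "(\<And>i. i \<in> S \<Longrightarrow> Ck_on k U (f i)) \<Longrightarrow> Ck_on k U (\<lambda>x. \<Sum>i\<in>S. f i x)"
  by (induction S rule: infinite_finite_induct) (auto intro: Ck_on_const Ck_on_add)

lemma Ck_on_prod:
  fixes f :: "'i \<Rightarrow> 'a::real_normed_vector \<Rightarrow> 'b::real_normed_field"
  shows "(\<And>i. i \<in> S \<Longrightarrow> Ck_on k U (f i)) \<Longrightarrow> Ck_on k U (\<lambda>x. \<Prod>i\<in>S. f i x)"
  by (induction S rule: infinite_finite_induct)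
     (auto intro: Ck_on_const Ck_on_bounded_bilinear[OF bounded_bilinear_mult])

lemma Ck_on_vec:
  fixes f :: "'a::real_normed_vector \<Rightarrow> 'b::real_normed_vector ^ 'n"
  assumes "\<And>i. Ck_on k U (\<lambda>x. f x $ i)"
  shows "Ck_on k U f"
proof -
  have lin: "bounded_linear (\<lambda>y::'b. axis i y :: 'b ^ 'n)" for i
  proof
    show "\<exists>K. \<forall>x. norm (axis i x :: 'b ^ 'n) \<le> norm x * K"
    proof (rule exI[of _ 1], rule allI)
      fix x :: 'b
      have "(\<Sum>j\<in>UNIV. (norm ((axis i x :: 'b ^ 'n) $ j))\<^sup>2) = (\<Sum>j\<in>UNIV. if j = i then (norm x)\<^sup>2 else 0)"
        by (intro sum.cong) (auto simp: axis_def)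
      then show "norm (axis i x :: 'b ^ 'n) \<le> norm x * 1"
        by (simp add: norm_vec_def L2_set_def)
    qed
  qed (auto simp: axis_def vec_eq_iff)
  have "f x = (\<Sum>i\<in>UNIV. axis i (f x $ i))" for x
    by (simp add: vec_eq_iff axis_def)
  moreover have "Ck_on k U (\<lambda>x. \<Sum>i\<in>UNIV. axis i (f x $ i))"
    by (intro Ck_on_sum Ck_on_bounded_linear[OF lin] assms)
  ultimately show ?thesis by simp
qed

lemma Ck_on_vec_nth: "Ck_on k U f \<Longrightarrow> Ck_on k U (\<lambda>x. f x $ i)"
  by (rule Ck_on_bounded_linear[OF bounded_linear_vec_nth])

lemma Ck_on_det:
  fixes M :: "'a::real_normed_vector \<Rightarrow> 'b::real_normed_field ^ 'n ^ 'n"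
  assumes "\<And>i j. Ck_on k U (\<lambda>x. M x $ i $ j)"
  shows "Ck_on k U (\<lambda>x. det (M x))"
  unfolding det_def
  by (intro Ck_on_sum Ck_on_prod Ck_on_bounded_bilinear[OF bounded_bilinear_mult] Ck_on_const assms)

section \<open>Smoothness of the solution\<close>

lemma det_conj_transpose: "det (conj_transpose A) = cnj (det A)"
proof -
  have "det (conj_transpose A) = det (transpose (conj_transpose A))"
    by (simp add: det_transpose)
  also have "\<dots> = det (\<chi> i j. cnj (A $ i $ j))"
    by (simp add: transpose_def conj_transpose_def)
  also have "\<dots> = cnj (det A)"
    by (simp add: det_def)
  finally show ?thesis .
qed

text \<open>By Cramer's rule the factor \<open>cnj (det A)\<close> turns the inverse of \<open>A\<^sup>*\<close> into its adjugate, so the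
  right-hand side of the differential equation is polynomial in \<open>cnj A\<close>.\<close>

lemma conj_transpose_cramer:
  fixes A :: "complex ^ 'n ^ 'n"
  assumes "invertible A" and x: "conj_transpose A *v x = cnj (det A) *s b"
  shows "x $ k = det (\<chi> i l. if l = k then b $ i else cnj (A $ l $ i))"
proof -
  have nz: "det A \<noteq> 0" using assms(1) invertible_det_nz by blast
  have "conj_transpose A *v ((1 / cnj (det A)) *s x) = b"
    using x nz by (simp add: vector_scalar_commute vector_smult_assoc)
  then have "(1 / cnj (det A)) *s x =
      (\<chi> k. det (\<chi> i j. if j = k then b $ i else conj_transpose A $ i $ j) / det (conj_transpose A))"
    using cramer[of "conj_transpose A"] nz by (simp add: det_conj_transpose)
  from arg_cong[OF this, of "\<lambda>y. y $ k"]
  have "x $ k / cnj (det A) =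
      det (\<chi> i j. if j = k then b $ i else conj_transpose A $ i $ j) / cnj (det A)"
    by (simp add: det_conj_transpose)
  then have "x $ k = det (\<chi> i j. if j = k then b $ i else conj_transpose A $ i $ j)"
    using nz by simp
  then show ?thesis
    by (simp add: conj_transpose_def cong: if_cong)
qed

text \<open>Each component of \<open>x s\<close> is a determinant whose entries are constants or
  conjugated entries of \<open>A s\<close>, so \<open>x\<close> inherits the regularity of
  \<open>A\<close>.\<close>

lemma Ck_on_conj_transpose_cramer:
  fixes A :: "real \<Rightarrow> complex ^ 'n ^ 'n"
  assumes "Ck_on k I A" "\<And>s. s \<in> I \<Longrightarrow> invertible (A s)"
    "\<And>s. s \<in> I \<Longrightarrow> conj_transpose (A s) *v x s = cnj (det (A s)) *s b"
  shows "Ck_on k I x"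
proof (rule Ck_on_vec)
  fix m
  have "Ck_on k I (\<lambda>s. cnj (A s $ l $ i))" for i l
    by (intro Ck_on_bounded_linear[OF bounded_linear_cnj] Ck_on_vec_nth assms(1))
  then have "Ck_on k I (\<lambda>s. if l = m then b $ i else cnj (A s $ l $ i))" for i l
    by (cases "l = m") (simp_all add: Ck_on_const)
  then have "Ck_on k I (\<lambda>s. det (\<chi> i l. if l = m then b $ i else cnj (A s $ l $ i)))"
    by (intro Ck_on_det) simp
  then show "Ck_on k I (\<lambda>s. x s $ m)"
    by (rule Ck_on_cong) (rule conj_transpose_cramer[OF assms(2,3), symmetric])
qed

lemma Ck_on_SucI_vector_derivative:
  assumes "\<And>s. s \<in> I \<Longrightarrow> (f has_vector_derivative f' s) (at s within I)" "Ck_on k I f'"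
  shows "Ck_on (Suc k) I f"
  using assms
  by (auto simp: has_vector_derivative_def intro!: exI[of _ "\<lambda>s h. h *\<^sub>R f' s"]
      Ck_on_bounded_linear[OF bounded_linear_scaleR_right])

text \<open>A bootstrap: \<open>A\<close> is continuous because it is differentiable, and if
  \<open>A\<close> is of class \<open>k\<close>, then so is \<open>A'\<close> by Cramer's formula,
  hence \<open>A\<close> is of class \<open>k + 1\<close>. The regularity of \<open>a\<close> then
  follows from that of \<open>A\<close>.\<close>

lemma smooth_solution:
  fixes A A' :: "real \<Rightarrow> complex ^ 'n ^ 'n" and a a' :: "real \<Rightarrow> complex ^ 'n"
  assumes inv: "\<And>s. s \<in> I \<Longrightarrow> invertible (A s)"
    and dA: "\<And>s. s \<in> I \<Longrightarrow> (A has_vector_derivative A' s) (at s within I)"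
    and da: "\<And>s. s \<in> I \<Longrightarrow> (a has_vector_derivative a' s) (at s within I)"
    and eA: "\<And>s. s \<in> I \<Longrightarrow> conj_transpose (A s) ** A' s = (\<chi> i j. cnj (det (A s)) * B $ i $ j)"
    and ea: "\<And>s. s \<in> I \<Longrightarrow> conj_transpose (A s) *v a' s = cnj (det (A s)) *s b"
  shows "Ck_on k I A" "Ck_on k I a"
proof -
  \<comment> \<open>The matrix equation is read column by column, so that each column of
    \<open>A'\<close> solves a linear system of the form treated by Cramer's formula.\<close>
  have eA': "conj_transpose (A s) *v (\<chi> i. A' s $ i $ j) = cnj (det (A s)) *s (\<chi> i. B $ i $ j)"
    if "s \<in> I" for s j
    using eA[OF that] by (simp add: vec_eq_iff matrix_matrix_mult_def matrix_vector_mult_def)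
  have A': "Ck_on k I A'" if "Ck_on k I A" for k
  proof (intro Ck_on_vec)
    fix i j
    have "Ck_on k I (\<lambda>s. \<chi> i. A' s $ i $ j)"
      using Ck_on_conj_transpose_cramer[OF that inv eA'] by blast
    from Ck_on_vec_nth[OF this, of i] show "Ck_on k I (\<lambda>s. A' s $ i $ j)" by simp
  qed
  show A: "Ck_on k I A" for k
  proof (induction k)
    case 0
    show ?case
      using dA by (auto simp: continuous_on_eq_continuous_within intro: has_vector_derivative_continuous)
  next
    case (Suc k)
    then show ?case using Ck_on_SucI_vector_derivative[OF dA A'] by blast
  qed
  have "Ck_on (Suc k) I a"
    using Ck_on_SucI_vector_derivative[OF da Ck_on_conj_transpose_cramer[OF A inv ea]] by blast
  then show "Ck_on k I a" by (rule Ck_on_Suc_imp)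
qed

section \<open>Tangent spaces in a parametrization\<close>

text \<open>At a boundary point of a half-space chart a ray along \<open>v\<close> may leave the
  domain, but then the ray along \<open>-v\<close> stays inside for a short time.\<close>

lemma chart_inward_direction:
  fixes U :: "'e::euclidean_space set"
  assumes op: "openin (top_of_set (V \<inter> {x. c \<le> v0 \<bullet> x})) U"
    and V: "subspace V" and u: "u \<in> U" and v: "v \<in> V"
  obtains \<sigma> \<epsilon> :: real where "\<sigma> = 1 \<or> \<sigma> = -1" "\<epsilon> > 0"
    "\<And>t. 0 \<le> t \<Longrightarrow> t < \<epsilon> \<Longrightarrow> u + t *\<^sub>R (\<sigma> *\<^sub>R v) \<in> U"
proof -
  from op u obtain d where d: "d > 0" "ball u d \<inter> (V \<inter> {x. c \<le> v0 \<bullet> x}) \<subseteq> U"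
    unfolding openin_contains_ball by blast
  have uV: "u \<in> V" "c \<le> v0 \<bullet> u" using op u openin_imp_subset by blast+
  \<comment> \<open>The sign makes \<sigma> \<open>v\<close> point into the half-space or along its
    boundary.\<close>
  define \<sigma> :: real where "\<sigma> = (if v0 \<bullet> v \<ge> 0 then 1 else -1)"
  have \<sigma>: "\<sigma> = 1 \<or> \<sigma> = -1" by (simp add: \<sigma>_def)
  have pos: "d / (norm v + 1) > 0" using d(1) by (simp add: add_nonneg_pos)
  moreover have "u + t *\<^sub>R (\<sigma> *\<^sub>R v) \<in> U" if t: "0 \<le> t" "t < d / (norm v + 1)" for t
  proof -
    have "t * (norm v + 1) < d"
      using t(2) by (simp add: pos_less_divide_eq add_nonneg_pos)
    then have "t * norm v < d" using t(1) by (simp add: algebra_simps)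
    then have "u + t *\<^sub>R (\<sigma> *\<^sub>R v) \<in> ball u d"
      using t(1) \<sigma> by (auto simp: dist_norm)
    moreover have "u + t *\<^sub>R (\<sigma> *\<^sub>R v) \<in> V"
      using V uV v by (simp add: subspace_add subspace_scale)
    moreover have "0 \<le> t * (\<sigma> * (v0 \<bullet> v))"
      using t(1) by (auto simp: \<sigma>_def mult_nonneg_nonpos)
    then have "c \<le> v0 \<bullet> (u + t *\<^sub>R (\<sigma> *\<^sub>R v))"
      using uV(2) by (simp add: inner_add_right)
    ultimately show ?thesis using d(2) by blast
  qed
  ultimately show thesis using that \<sigma> by blast
qed

lemma has_derivative_along_ray:
  assumes f: "(f has_derivative D) (at u within U)"
    and ray: "\<And>t. 0 \<le> t \<Longrightarrow> t < \<epsilon> \<Longrightarrow> u + t *\<^sub>R w \<in> U"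
  shows "((\<lambda>t. f (u + t *\<^sub>R w)) has_vector_derivative D w) (at 0 within {0..<\<epsilon>})"
proof -
  have 1: "((\<lambda>t. u + t *\<^sub>R w) has_derivative (\<lambda>t. t *\<^sub>R w)) (at 0 within {0..<\<epsilon>})"
    by (auto intro!: derivative_eq_intros)
  have "(f has_derivative D) (at (u + 0 *\<^sub>R w) within (\<lambda>t. u + t *\<^sub>R w) ` {0..<\<epsilon>})"
    using f ray by (auto intro: has_derivative_subset)
  from diff_chain_within[OF 1 this] show ?thesis
    using linear_scale[OF has_derivative_linear[OF f]]
    by (simp add: o_def has_vector_derivative_def)
qed

text \<open>The one-sided derivative along an admissible ray fixes both derivatives at
  \<open>v\<close> or at \<open>-v\<close>, and linearity removes the sign. Since \<open>U\<close>
  lies in \<open>V\<close>, uniqueness is claimed for directions in \<open>V\<close>.\<close>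

lemma chart_derivative_unique:
  fixes U :: "'e::euclidean_space set"
  assumes op: "openin (top_of_set (V \<inter> {x. c \<le> v0 \<bullet> x})) U"
    and V: "subspace V" and u: "u \<in> U" and v: "v \<in> V"
    and D: "(f has_derivative D) (at u within U)" "(f has_derivative D') (at u within U)"
  shows "D v = D' v"
proof -
  obtain \<sigma> \<epsilon> :: real where s: "\<sigma> = 1 \<or> \<sigma> = -1" "\<epsilon> > 0"
    "\<And>t. 0 \<le> t \<Longrightarrow> t < \<epsilon> \<Longrightarrow> u + t *\<^sub>R (\<sigma> *\<^sub>R v) \<in> U"
    using chart_inward_direction[OF op V u v] by metis
  have "at 0 within {0..<\<epsilon>} \<noteq> bot"
  proof -
    have "{0..<\<epsilon>} - {0} = {0<..<\<epsilon>}" by auto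
    then show ?thesis using s(2) by (simp add: at_within_eq_bot_iff)
  qed
  then have "D (\<sigma> *\<^sub>R v) = D' (\<sigma> *\<^sub>R v)"
    using has_derivative_along_ray[OF D(1) s(3)] has_derivative_along_ray[OF D(2) s(3)]
    by (meson vector_derivative_unique_within)
  then show ?thesis
    using s(1) linear_scale[OF has_derivative_linear[OF D(1)]]
      linear_scale[OF has_derivative_linear[OF D(2)]] by auto
qed

text \<open>Injectivity of \<open>D'\<close> bounds \<open>\<tau>\<close> linearly near \<open>u\<close>, so the difference quotients of \<open>\<tau>\<close> along the
  ray stay bounded and their images under \<open>D'\<close> approach \<open>D w\<close>; differentiability of \<open>\<tau>\<close> is not
  required.\<close>

lemma derivative_in_range_of_reparametrization:
  fixes g :: "'e::euclidean_space \<Rightarrow> 'f::euclidean_space"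
  assumes f: "(f has_derivative D) (at u within U)" and "u \<in> U"
    and "\<epsilon> > 0" and ray: "\<And>t. 0 \<le> t \<Longrightarrow> t < \<epsilon> \<Longrightarrow> u + t *\<^sub>R w \<in> U"
    and \<tau>: "continuous_on U \<tau>" "\<tau> ` U \<subseteq> W" "\<And>x. x \<in> U \<Longrightarrow> f x = g (\<tau> x)"
    and g: "(g has_derivative D') (at (\<tau> u) within W)"
    and V: "subspace V" "W \<subseteq> V" "inj_on D' V"
  shows "D w \<in> D' ` V"
proof -
  have lin: "linear D'" using g has_derivative_linear by blast
  \<comment> \<open>The range is a finite-dimensional subspace, hence closed, so it suffices to
    approximate \<open>D w\<close> by its elements.\<close>
  have cl: "closed (D' ` V)"
    using lin V(1) by (simp add: closed_subspace linear_subspace_image)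
  \<comment> \<open>An injective linear map on a finite-dimensional subspace is bounded
    below.\<close>
  obtain c where c: "c > 0" "\<And>x. x \<in> V \<Longrightarrow> c * norm x \<le> norm (D' x)"
  proof -
    have "\<forall>x\<in>V. D' x = 0 \<longrightarrow> x = 0"
      using V lin by (metis inj_onD linear_0 subspace_0)
    from injective_imp_isometric[OF closed_subspace[OF V(1)] V(1) has_derivative_bounded_linear[OF g] this]
    show thesis using that by blast
  qed
  have k0: "((\<lambda>t. \<tau> (u + t *\<^sub>R w)) \<longlongrightarrow> \<tau> u) (at 0 within {0..<\<epsilon>})"
  proof -
    have "continuous_on {0..<\<epsilon>} (\<lambda>t. \<tau> (u + t *\<^sub>R w))"
      using ray by (intro continuous_on_compose2[OF \<tau>(1)] continuous_intros) auto
    then show ?thesis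
      using \<open>\<epsilon> > 0\<close> unfolding continuous_on_def by force
  qed
  have "\<exists>y\<in>D' ` V. dist y (D w) < \<eta>" if \<eta>: "\<eta> > 0" for \<eta>
  proof -
    define N where "N = norm (D w) + 1"
    have N: "N > 0" by (simp add: N_def add_nonneg_pos)
    \<comment> \<open>The bound \<open>c/2\<close> lets the linearization error of \<open>g\<close>
      be absorbed by the lower bound for \<open>D'\<close>, which gives
      \<open>c/2 * norm z \<le> N * t\<close>. The second bound then makes that error at most
      \<eta>\<open>/2 * t\<close>.\<close>
    define e where "e = min (c/2) (\<eta> * c / (4 * N))"
    have e: "e > 0" "e \<le> c/2" "e \<le> \<eta> * c / (4 * N)" using c(1) \<eta> N by (auto simp: e_def)
    obtain \<delta> where \<delta>: "\<delta> > 0" "\<And>y. y \<in> W \<Longrightarrow> norm (y - \<tau> u) < \<delta> \<Longrightarrow>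
        norm (g y - g (\<tau> u) - D' (y - \<tau> u)) \<le> e * norm (y - \<tau> u)"
      using g e(1) unfolding has_derivative_within_alt by blast
    \<comment> \<open>The bound 1 keeps the increment of \<open>f\<close> below
      \<open>N * t\<close>; the bound \<eta>\<open>/4\<close> keeps the sum of the two errors
      strictly below \<eta>\<open>* t\<close>.\<close>
    define e2 where "e2 = min 1 (\<eta>/4)"
    have e2: "e2 > 0" "e2 \<le> 1" "e2 \<le> \<eta>/4" using \<eta> by (auto simp: e2_def)
    obtain \<delta>2 where \<delta>2: "\<delta>2 > 0" "\<And>t. t \<in> {0..<\<epsilon>} \<Longrightarrow> norm t < \<delta>2 \<Longrightarrow>
        norm (f (u + t *\<^sub>R w) - f u - t *\<^sub>R D w) \<le> e2 * norm t"
    proof -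
      obtain d where "d > 0" "\<forall>t\<in>{0..<\<epsilon>}. norm (t - 0) < d \<longrightarrow>
          norm (f (u + t *\<^sub>R w) - f (u + 0 *\<^sub>R w) - (t - 0) *\<^sub>R D w) \<le> e2 * norm (t - 0)"
        using has_derivative_along_ray[OF f ray] e2(1)
        unfolding has_vector_derivative_def has_derivative_within_alt by blast
      then show thesis using that[of d] by simp
    qed
    obtain \<delta>3 where \<delta>3: "\<delta>3 > 0" "\<And>t. t \<in> {0..<\<epsilon>} \<Longrightarrow> t \<noteq> 0 \<Longrightarrow> norm t < \<delta>3 \<Longrightarrow> norm (\<tau> (u + t *\<^sub>R w) - \<tau> u) < \<delta>"
    proof -
      obtain d where "d > 0" "\<forall>t\<in>{0..<\<epsilon>}. 0 < dist t 0 \<and> dist t 0 < d \<longrightarrow>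
          dist (\<tau> (u + t *\<^sub>R w)) (\<tau> u) < \<delta>"
        using k0 \<delta>(1) unfolding Lim_within by blast
      then show thesis using that[of d] by (simp add: dist_norm)
    qed
    define t where "t = min (\<epsilon>/2) (min (\<delta>2/2) (\<delta>3/2))"
    have t: "t > 0" "t \<in> {0..<\<epsilon>}" "norm t < \<delta>2" "norm t < \<delta>3"
      using \<open>\<epsilon> > 0\<close> \<delta>2(1) \<delta>3(1) by (auto simp: t_def min_def)
    define z where "z = \<tau> (u + t *\<^sub>R w) - \<tau> u"
    have tU: "u + t *\<^sub>R w \<in> U" using ray t by auto
    have zV: "z \<in> V" using tU \<open>u \<in> U\<close> \<tau>(2) V(1,2) unfolding z_def by (intro subspace_diff) auto
    have "norm z < \<delta>" using \<delta>3(2)[OF t(2)] t by (auto simp: z_def)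
    then have 1: "norm (f (u + t *\<^sub>R w) - f u - D' z) \<le> e * norm z"
      using \<delta>(2)[of "\<tau> (u + t *\<^sub>R w)"] tU \<tau>(2,3) \<open>u \<in> U\<close> by (auto simp: z_def)
    have 2: "norm (f (u + t *\<^sub>R w) - f u - t *\<^sub>R D w) \<le> e2 * t"
      using \<delta>2(2)[OF t(2,3)] t by auto
    have 3: "norm (f (u + t *\<^sub>R w) - f u) \<le> N * t"
    proof -
      have "norm (f (u + t *\<^sub>R w) - f u) \<le> norm (t *\<^sub>R D w) + e2 * t"
        using 2 norm_triangle_sub[of "f (u + t *\<^sub>R w) - f u" "t *\<^sub>R D w"] by linarith
      also have "\<dots> \<le> t * norm (D w) + 1 * t"
        using e2(2) t(1) by (intro add_mono mult_right_mono) auto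
      finally show ?thesis by (simp add: N_def algebra_simps)
    qed
    have "norm (D' z) \<le> norm (f (u + t *\<^sub>R w) - f u) + norm (f (u + t *\<^sub>R w) - f u - D' z)"
      using norm_triangle_sub[of "D' z" "f (u + t *\<^sub>R w) - f u"]
      by (simp add: norm_minus_commute)
    then have "c * norm z \<le> N * t + e * norm z"
      using c(2)[OF zV] 1 3 by linarith
    also have "\<dots> \<le> N * t + c/2 * norm z"
      using e(2) by (intro add_left_mono mult_right_mono) auto
    finally have 4: "c/2 * norm z \<le> N * t" by simp
    have "e * norm z \<le> \<eta> * c / (4 * N) * norm z" using e(3) by (intro mult_right_mono) auto
    also have "\<dots> = \<eta> / (2 * N) * (c/2 * norm z)" by simp
    also have "\<dots> \<le> \<eta> / (2 * N) * (N * t)" using 4 \<eta> N by (intro mult_left_mono) auto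
    also have "\<dots> = \<eta>/2 * t" using N by simp
    finally have 5: "norm (f (u + t *\<^sub>R w) - f u - D' z) \<le> \<eta>/2 * t" using 1 by linarith
    have "norm (D' z - t *\<^sub>R D w) \<le> norm (f (u + t *\<^sub>R w) - f u - D' z) + norm (f (u + t *\<^sub>R w) - f u - t *\<^sub>R D w)"
      using norm_triangle_ineq4[of "f (u + t *\<^sub>R w) - f u - t *\<^sub>R D w" "f (u + t *\<^sub>R w) - f u - D' z"]
      by (simp add: algebra_simps)
    also have "\<dots> \<le> \<eta>/2 * t + \<eta>/4 * t"
      using 5 2 mult_right_mono[OF e2(3), of t] t(1) by linarith
    also have "\<dots> < \<eta> * t" using \<eta> t(1) by simp
    finally have 6: "norm (D' z - t *\<^sub>R D w) < \<eta> * t" .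
    have "D' ((1/t) *\<^sub>R z) - D w = (1/t) *\<^sub>R (D' z - t *\<^sub>R D w)"
      using t(1) by (simp add: linear_scale[OF lin] scaleR_diff_right)
    then have "dist (D' ((1/t) *\<^sub>R z)) (D w) = norm (D' z - t *\<^sub>R D w) / t"
      using t(1) by (simp add: dist_norm)
    also have "\<dots> < \<eta>" using 6 t(1) by (simp add: pos_divide_less_eq)
    finally show ?thesis using zV V(1) subspace_scale by blast
  qed
  then show ?thesis using cl closed_approachable by blast
qed

lemma tangent_space_eq_chart:
  fixes X :: "'p \<Rightarrow> 'e::euclidean_space"
  assumes ch: "local_param k M X V U \<phi>" and u: "u \<in> U"
    and D: "((X \<circ> \<phi>) has_derivative D) (at u within U)"
  shows "tangent_space k M X (\<phi> u) = D ` V"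
proof
  show "D ` V \<subseteq> tangent_space k M X (\<phi> u)"
    unfolding tangent_space_def using assms by blast
  show "tangent_space k M X (\<phi> u) \<subseteq> D ` V"
  proof
    fix y assume "y \<in> tangent_space k M X (\<phi> u)"
    then obtain D2 v V2 U2 \<psi> u2 where y: "y = D2 v" and ch2: "local_param k M X V2 U2 \<psi>"
      and u2: "u2 \<in> U2" "\<psi> u2 = \<phi> u" and D2: "((X \<circ> \<psi>) has_derivative D2) (at u2 within U2)"
      and v: "v \<in> V2"
      unfolding tangent_space_def by blast
    obtain \<phi>i where "homeomorphic_maps (top_of_set U) (subtopology M (\<phi> ` U)) \<phi> \<phi>i"
      using ch unfolding local_param_def homeomorphic_map_maps by blast
    then have \<phi>i: "continuous_map (subtopology M (\<phi> ` U)) (top_of_set U) \<phi>i"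
        "\<And>x. x \<in> U \<Longrightarrow> \<phi>i (\<phi> x) = x"
      by (auto simp: homeomorphic_maps_def)
    have op: "openin M (\<phi> ` U)" using ch by (simp add: local_param_def)
    have cont2: "continuous_map (top_of_set U2) M \<psi>"
      using ch2 homeomorphic_imp_continuous_map continuous_map_into_fulltopology
      unfolding local_param_def by blast
    \<comment> \<open>The second chart is shrunk to the overlap, which stays relatively open in its
      half-space.\<close>
    define U3 where "U3 = {x \<in> topspace (top_of_set U2). \<psi> x \<in> \<phi> ` U}"
    have op3: "openin (top_of_set U2) U3"
      unfolding U3_def by (rule openin_continuous_map_preimage[OF cont2 op])
    obtain v0 c where "openin (top_of_set (V2 \<inter> {x. c \<le> v0 \<bullet> x})) U2"
      using ch2 unfolding local_param_def by blast
    then have op3': "openin (top_of_set (V2 \<inter> {x. c \<le> v0 \<bullet> x})) U3"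
      using op3 openin_trans by blast
    have sub: "U3 \<subseteq> U2" by (auto simp: U3_def)
    have u3: "u2 \<in> U3" using u2 u by (auto simp: U3_def)
    have V2: "subspace V2" using ch2 by (simp add: local_param_def)
    have "continuous_map (top_of_set U3) (subtopology M (\<phi> ` U)) \<psi>"
      using continuous_map_from_subtopology_mono[OF cont2 sub]
      by (auto simp: continuous_map_in_subtopology U3_def)
    then have "continuous_map (top_of_set U3) (top_of_set U) (\<phi>i \<circ> \<psi>)"
      using \<phi>i(1) continuous_map_compose by blast
    then have \<tau>: "continuous_on U3 (\<phi>i \<circ> \<psi>)" "(\<phi>i \<circ> \<psi>) ` U3 \<subseteq> U"
      by auto
    have eq: "(X \<circ> \<psi>) x = (X \<circ> \<phi>) ((\<phi>i \<circ> \<psi>) x)" if "x \<in> U3" for x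
      using that \<phi>i(2) by (auto simp: U3_def)
    have D3: "((X \<circ> \<psi>) has_derivative D2) (at u2 within U3)"
      using D2 sub has_derivative_subset by blast
    obtain \<sigma> \<epsilon> :: real where s: "\<sigma> = 1 \<or> \<sigma> = -1" "\<epsilon> > 0"
      "\<And>t. 0 \<le> t \<Longrightarrow> t < \<epsilon> \<Longrightarrow> u2 + t *\<^sub>R (\<sigma> *\<^sub>R v) \<in> U3"
      using chart_inward_direction[OF op3' V2 u3 v] by metis
    obtain v1 c1 where "openin (top_of_set (V \<inter> {x. c1 \<le> v1 \<bullet> x})) U"
      using ch unfolding local_param_def by blast
    from openin_imp_subset[OF this] have "U \<subseteq> V" by blast
    moreover have "subspace V" "inj_on D V"
      using ch u D by (simp_all add: local_param_def)
    ultimately have V: "subspace V" "U \<subseteq> V" "inj_on D V" by auto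
    have \<tau>u: "(\<phi>i \<circ> \<psi>) u2 = u" using u2 u \<phi>i(2) by simp
    have D': "((X \<circ> \<phi>) has_derivative D) (at ((\<phi>i \<circ> \<psi>) u2) within U)"
      unfolding \<tau>u by (rule D)
    \<comment> \<open>Only one of the rays along \<open>v\<close> and \<open>-v\<close> need stay in
      \<open>U3\<close>; the claim is shown for that one and carried to \<open>v\<close> by
      linearity.\<close>
    have "D2 (\<sigma> *\<^sub>R v) \<in> D ` V"
      by (rule derivative_in_range_of_reparametrization[OF D3 u3 s(2,3) \<tau> eq D' V])
    moreover have "subspace (D ` V)"
      by (rule linear_subspace_image[OF has_derivative_linear[OF D] V(1)])
    moreover have "D2 v = \<sigma> *\<^sub>R D2 (\<sigma> *\<^sub>R v)"
      using s(1) linear_scale[OF has_derivative_linear[OF D2]] by auto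
    ultimately show "y \<in> D ` V" using y subspace_scale by metis
  qed
qed

section \<open>The Hermitian product\<close>

lemma herm_add_left: "herm (u + v) w = herm u w + herm v w"
  and herm_add_right: "herm u (v + w) = herm u v + herm u w"
  and herm_smult_left: "herm (c *s u) v = c * herm u v"
  and herm_smult_right: "herm u (c *s v) = cnj c * herm u v"
  and herm_scaleR_left: "herm (r *\<^sub>R u) v = r *\<^sub>R herm u v"
  and herm_scaleR_right: "herm u (r *\<^sub>R v) = r *\<^sub>R herm u v"
  and herm_commute: "herm v u = cnj (herm u v)"
  by (simp_all add: herm_def sum.distrib sum_distrib_left scaleR_sum_right algebra_simps)

lemma herm_self: "herm v v = of_real ((norm v)\<^sup>2)"
proof -
  have "(norm v)\<^sup>2 = (\<Sum>i\<in>UNIV. (norm (v $ i))\<^sup>2)"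
    by (simp add: norm_vec_def L2_set_def sum_nonneg)
  then show ?thesis
    by (simp add: herm_def complex_norm_square[symmetric])
qed

lemma herm_adjoint: "herm (A *v v) w = herm v (conj_transpose A *v w)"
proof -
  have "herm (A *v v) w = (\<Sum>i\<in>UNIV. \<Sum>j\<in>UNIV. A $ i $ j * v $ j * cnj (w $ i))"
    by (simp add: herm_def matrix_vector_mult_def sum_distrib_right)
  also have "\<dots> = (\<Sum>j\<in>UNIV. \<Sum>i\<in>UNIV. A $ i $ j * v $ j * cnj (w $ i))"
    by (rule sum.swap)
  also have "\<dots> = herm v (conj_transpose A *v w)"
    by (simp add: herm_def matrix_vector_mult_def conj_transpose_def sum_distrib_left algebra_simps)
  finally show ?thesis .
qed

lemma bounded_bilinear_herm: "bounded_bilinear herm"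
  unfolding bilinear_conv_bounded_bilinear[symmetric] bilinear_def
  by (auto intro!: linearI simp: herm_add_left herm_add_right herm_scaleR_left herm_scaleR_right)

lemma matrix_vector_scaleR_left: "(r *\<^sub>R A) *v x = r *\<^sub>R (A *v x)"
  for A :: "complex ^ 'n ^ 'm"
  by (simp add: matrix_vector_mult_def vec_eq_iff scaleR_sum_right)

lemma matrix_vector_scaleR_right: "A *v (r *\<^sub>R x) = r *\<^sub>R (A *v x)"
  for A :: "complex ^ 'n ^ 'm"
  by (simp add: matrix_vector_mult_def vec_eq_iff scaleR_sum_right)

lemma bounded_bilinear_matrix_vector_mult:
  "bounded_bilinear ((*v) :: complex ^ 'n ^ 'm \<Rightarrow> complex ^ 'n \<Rightarrow> complex ^ 'm)"
  unfolding bilinear_conv_bounded_bilinear[symmetric] bilinear_def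
  by (auto intro!: linearI simp: matrix_vector_right_distrib matrix_vector_mult_add_rdistrib
      matrix_vector_scaleR_left matrix_vector_scaleR_right)

lemma linear_matrix_vector_mult: "linear ((*v) A)" for A :: "complex ^ 'n ^ 'm"
  by (auto intro!: linearI simp: matrix_vector_right_distrib matrix_vector_scaleR_right)

text \<open>The mixed terms vanish because the full Hermitian product with \<open>w\<close> does,
  and the product of two real multiples of \<open>w\<close> is real; only the pairing inside
  \<open>T\<close> is left.\<close>

lemma kaehler_form_add_line:
  assumes T: "\<And>x y. x \<in> T \<Longrightarrow> y \<in> T \<Longrightarrow> kaehler_form x y = 0"
    and w: "\<And>x. x \<in> T \<Longrightarrow> herm x w = 0"
    and "x \<in> {v + r *\<^sub>R w | v r. v \<in> T}" "y \<in> {v + r *\<^sub>R w | v r. v \<in> T}"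
  shows "kaehler_form x y = 0"
proof -
  from assms(3,4) obtain v r v' r' where "v \<in> T" "v' \<in> T" "x = v + r *\<^sub>R w" "y = v' + r' *\<^sub>R w"
    by blast
  then show ?thesis
    using T[of v v'] w[of v] w[of v'] herm_commute[of w v']
    by (simp add: kaehler_form_def herm_add_left herm_add_right herm_scaleR_left herm_scaleR_right
        herm_self)
qed

section \<open>The Lagrangian angle\<close>

lemma span_range_coordinates:
  fixes e :: "'n::finite \<Rightarrow> 'a::real_vector"
  assumes "inj e" "x \<in> span (range e)"
  obtains c where "x = (\<Sum>i\<in>UNIV. c i *\<^sub>R e i)"
proof -
  from assms(2) obtain u where "x = (\<Sum>v\<in>range e. u v *\<^sub>R v)"
    by (auto simp: span_finite)
  then have "x = (\<Sum>i\<in>UNIV. u (e i) *\<^sub>R e i)"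
    by (simp add: sum.reindex[OF assms(1)])
  then show thesis by (rule that)
qed

lemma complex_scaleR: "r *\<^sub>R z = of_real r * z" for z :: complex
  by (rule scaleR_conv_of_real)

lemma det_of_real: "det (\<chi> i j. of_real (R i j)) = (of_real (det (\<chi> i j. R i j)) :: complex)"
  by (simp add: det_def)

text \<open>The matrix of \<open>f\<close> is the matrix of \<open>e\<close> times a real
  coefficient matrix, whose determinant is the factor.\<close>

lemma det_columns_real_multiple:
  fixes e f :: "'n \<Rightarrow> complex ^ 'n"
  assumes "inj e" "range f \<subseteq> span (range e)"
  obtains r :: real where "det (\<chi> i j. f j $ i) = of_real r * det (\<chi> i j. e j $ i)"
proof -
  have "\<forall>j. \<exists>c. f j = (\<Sum>i\<in>UNIV. c i *\<^sub>R e i)"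
    using span_range_coordinates[OF assms(1)] assms(2) by (metis range_subsetD)
  then obtain R where R: "\<And>j. f j = (\<Sum>i\<in>UNIV. R j i *\<^sub>R e i)"
    by metis
  have "(\<chi> i j. f j $ i) = (\<chi> i j. e j $ i) ** (\<chi> i j. of_real (R j i))"
    by (simp add: R matrix_matrix_mult_def vec_eq_iff complex_scaleR mult.commute)
  then have "det (\<chi> i j. f j $ i) = of_real (det (\<chi> i j. R j i)) * det (\<chi> i j. e j $ i)"
    by (simp add: det_mul det_of_real)
  then show thesis by (rule that)
qed

lemma Arg_real_multiple:
  assumes "r \<noteq> 0"
  obtains m :: int where "Arg (of_real r * z) = Arg z + of_int m * pi"
proof (cases "r > 0 \<or> z = 0")
  case True
  then show thesis using that[of 0] by auto
next
  case False
  then have "Arg (of_real r * z) = Arg (of_real (- r) * (- z))" "- r > 0" "z \<noteq> 0"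
    using assms by auto
  then have "Arg (of_real r * z) = Arg (- z)" by (metis Arg_times_of_real)
  then show thesis
    using that[of 1] that[of "-1"] \<open>z \<noteq> 0\<close> by (auto simp: Arg_minus split: if_splits)
qed

text \<open>Two real bases of \<open>P\<close> have determinants that differ by a real factor, and
  such a factor shifts \<open>Arg\<close> by a multiple of \<open>pi\<close>. Hence a single basis
  describes the whole coset.\<close>

lemma lagrangian_angle_eq:
  fixes e :: "'n \<Rightarrow> complex ^ 'n"
  assumes e: "inj e" "independent (range e)" "span (range e) = P"
  shows "lagrangian_angle P = {Arg (det (\<chi> i j. e j $ i)) + of_int m * pi | m :: int. True}"
proof
  show "{Arg (det (\<chi> i j. e j $ i)) + of_int m * pi | m :: int. True} \<subseteq> lagrangian_angle P"
    unfolding lagrangian_angle_def using e by blast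
  show "lagrangian_angle P \<subseteq> {Arg (det (\<chi> i j. e j $ i)) + of_int m * pi | m :: int. True}"
  proof
    fix \<theta> assume "\<theta> \<in> lagrangian_angle P"
    then obtain f :: "'n \<Rightarrow> complex ^ 'n" and m :: int
      where \<theta>: "\<theta> = Arg (det (\<chi> i j. f j $ i)) + of_int m * pi"
        and f: "inj f" "span (range f) = P"
      unfolding lagrangian_angle_def by blast
    have "range f \<subseteq> span (range e)" "range e \<subseteq> span (range f)"
      using e(3) f(2) span_superset by metis+
    then obtain r r' :: real where r: "det (\<chi> i j. f j $ i) = of_real r * det (\<chi> i j. e j $ i)"
      and r': "det (\<chi> i j. e j $ i) = of_real r' * det (\<chi> i j. f j $ i)"
      using det_columns_real_multiple e(1) f(1) by metis
    obtain m' :: int where "Arg (det (\<chi> i j. f j $ i)) = Arg (det (\<chi> i j. e j $ i)) + of_int m' * pi"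
    \<comment> \<open>If \<open>r\<close> vanishes, the relation with \<open>r'\<close> forces both
      determinants to be zero, so they agree without any appeal to nondegeneracy.\<close>
    proof (cases "r = 0")
      case True
      then have "det (\<chi> i j. f j $ i) = det (\<chi> i j. e j $ i)" using r r' by simp
      then show thesis using that[of 0] by simp
    next
      case False
      then show thesis using Arg_real_multiple[of r "det (\<chi> i j. e j $ i)"] r that by metis
    qed
    then have "\<theta> = Arg (det (\<chi> i j. e j $ i)) + of_int (m + m') * pi"
      using \<theta> by (simp add: algebra_simps)
    then show "\<theta> \<in> {Arg (det (\<chi> i j. e j $ i)) + of_int m * pi | m :: int. True}"
      by blast
  qed
qed

text \<open>Splitting the coefficients of a kernel vector into real and imaginary parts gives
  \<open>v + \<i> *s u = 0\<close> with \<open>u\<close> and \<open>v\<close> in the real span.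
  Isotropy makes \<open>herm v u\<close> real, while it equals \<open>-\<i>\<close> times the
  squared norm of \<open>u\<close>; so \<open>u\<close> and \<open>v\<close> vanish, and real
  independence kills the coefficients.\<close>

lemma det_isotropic_basis_nonzero:
  fixes e :: "'n \<Rightarrow> complex ^ 'n"
  assumes e: "inj e" "independent (range e)"
    and iso: "\<And>x y. x \<in> span (range e) \<Longrightarrow> y \<in> span (range e) \<Longrightarrow> kaehler_form x y = 0"
  shows "det (\<chi> i j. e j $ i) \<noteq> 0"
proof -
  have zero: "c i = 0" if "(\<Sum>i\<in>UNIV. c i *\<^sub>R e i) = 0" for c :: "'n \<Rightarrow> real" and i
  proof -
    have "(\<Sum>v\<in>range e. c (inv e v) *\<^sub>R v) = 0"
      using that by (simp add: sum.reindex[OF e(1)] e(1))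
    from independentD[OF e(2) _ _ this, of "e i"] show ?thesis using e(1) by simp
  qed
  have "x = 0" if x: "(\<chi> i j. e j $ i) *v x = 0" for x
  proof -
    define v where "v = (\<Sum>j\<in>UNIV. Re (x $ j) *\<^sub>R e j)"
    define u where "u = (\<Sum>j\<in>UNIV. Im (x $ j) *\<^sub>R e j)"
    have "e j $ i * x $ j = of_real (Re (x $ j)) * e j $ i + \<i> * (of_real (Im (x $ j)) * e j $ i)"
      for i j
      by (simp add: complex_eq_iff algebra_simps)
    then have "(\<chi> i j. e j $ i) *v x = v + \<i> *s u"
      by (simp add: vec_eq_iff matrix_vector_mult_def v_def u_def complex_scaleR
          sum.distrib sum_distrib_left)
    then have v: "v = - (\<i> *s u)" using x by (simp add: eq_neg_iff_add_eq_0)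
    then have v': "v = (- \<i>) *s u" by (simp add: vec_eq_iff)
    have "v \<in> span (range e)" "u \<in> span (range e)"
      unfolding v_def u_def by (rule span_sum, rule span_scale, rule span_base, rule rangeI)+
    then have "Im (herm v u) = 0" using iso by (simp add: kaehler_form_def)
    moreover have "herm v u = - \<i> * herm u u" unfolding v' by (rule herm_smult_left)
    ultimately have "u = 0" by (simp add: herm_self)
    then have "v = 0" using v by (simp add: vec_eq_iff)
    have "Re (x $ j) = 0" "Im (x $ j) = 0" for j
      using zero[OF \<open>v = 0\<close>[unfolded v_def]] zero[OF \<open>u = 0\<close>[unfolded u_def]] by auto
    then show "x = 0" by (simp add: vec_eq_iff complex_eq_iff)
  qed
  then have "invertible (\<chi> i j. e j $ i)"
    unfolding invertible_left_inverse matrix_left_invertible_ker by blast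
  then show ?thesis by (simp add: invertible_det_nz)
qed

text \<open>Reserving the index \<open>j0\<close> for \<open>w\<close> turns a basis of a hyperplane
  together with a transverse vector into a family indexed by the whole type, the form in which
  \<open>lagrangian_angle\<close> takes its bases.\<close>

lemma basis_add_line:
  fixes w :: "'a::real_vector"
  assumes g: "bij_betw g (UNIV - {j0}) S" and S: "independent S" and w: "w \<notin> span S"
  defines "e \<equiv> (\<lambda>j. if j = j0 then w else g j)"
  shows "inj e" "independent (range e)" "span (range e) = {v + r *\<^sub>R w | v r. v \<in> span S}"
proof -
  have "w \<notin> S" using w span_base by blast
  moreover have "g j \<in> S" if "j \<noteq> j0" for j using g that by (auto simp: bij_betw_def)
  moreover have "inj_on g (UNIV - {j0})" using g by (simp add: bij_betw_def)
  ultimately show "inj e"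
    unfolding inj_def e_def by (auto dest: inj_onD)
  have "range e = insert w (g ` (UNIV - {j0}))"
    by (auto simp: e_def image_def)
  then have r: "range e = insert w S" using g by (simp add: bij_betw_def)
  show "independent (range e)" unfolding r by (rule independent_insertI[OF w S])
  have "x \<in> span (insert w S) \<longleftrightarrow> x \<in> {v + r *\<^sub>R w | v r. v \<in> span S}" for x
  proof -
    have "x \<in> span (insert w S) \<longleftrightarrow> (\<exists>k. x - k *\<^sub>R w \<in> span S)" by (simp add: span_insert)
    also have "\<dots> \<longleftrightarrow> (\<exists>v r. v \<in> span S \<and> x = v + r *\<^sub>R w)"
      by (metis add_diff_cancel_right' diff_add_cancel)
    finally show ?thesis by blast
  qed
  then show "span (range e) = {v + r *\<^sub>R w | v r. v \<in> span S}" unfolding r by blast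
qed

section \<open>Transport of the subspace and its transverse direction by \<open>A\<close>\<close>

lemma matrix_image_hermitian_direction:
  fixes A :: "complex ^ 'n ^ 'n"
  assumes y: "conj_transpose A *v y = cnj (det A) *s w"
  shows "herm (A *v v) y = det A * herm v w"
  by (simp add: herm_adjoint y herm_smult_right)

text \<open>If \<open>y = A *v v\<close> with \<open>v\<close> in \<open>T\<close>, then
  \<open>herm y y\<close> is \<open>det A * herm v w = 0\<close>, so \<open>y\<close> vanishes; but
  its image under the conjugate transpose is a nonzero multiple of \<open>w\<close>.\<close>

lemma hermitian_direction_notin_image:
  fixes A :: "complex ^ 'n ^ 'n"
  assumes T: "\<And>x. x \<in> T \<Longrightarrow> herm x w = 0" and "w \<noteq> 0" and A: "invertible A"
    and y: "conj_transpose A *v y = cnj (det A) *s w"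
  shows "y \<notin> (*v) A ` T"
proof
  assume "y \<in> (*v) A ` T"
  then obtain v where v: "v \<in> T" "y = A *v v" by blast
  have "herm y y = 0"
    using matrix_image_hermitian_direction[OF y, of v] T[OF v(1)] v(2) by simp
  then have "y = 0" by (simp add: herm_self)
  then have "cnj (det A) *s w = 0" using y by simp
  then show False using \<open>w \<noteq> 0\<close> A invertible_det_nz by auto
qed

text \<open>Expanding \<open>A\<^sup>-\<^sup>1 y\<close> in the complex basis formed by \<open>T\<close> and \<open>w\<close>, only the \<open>w\<close>-component affects
  the determinant, and pairing with \<open>w\<close> shows that the determinant is multiplied by
  \<open>\<parallel>y\<parallel>\<^sup>2 / \<parallel>w\<parallel>\<^sup>2\<close>.\<close>

lemma lagrangian_angle_transport:
  fixes A :: "complex ^ 'n ^ 'n"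
  assumes T: "subspace T" "dim T = CARD('n) - 1"
    and iso: "\<And>x y. x \<in> T \<Longrightarrow> y \<in> T \<Longrightarrow> kaehler_form x y = 0"
    and Tw: "\<And>x. x \<in> T \<Longrightarrow> herm x w = 0" and w: "w \<noteq> 0" and A: "invertible A"
    and y: "conj_transpose A *v y = cnj (det A) *s w"
  shows "lagrangian_angle {v + r *\<^sub>R y | v r. v \<in> (*v) A ` T} = lagrangian_angle {v + r *\<^sub>R w | v r. v \<in> T}"
proof -
  obtain S where S: "S \<subseteq> T" "independent S" "T \<subseteq> span S" "card S = dim T"
    using basis_exists by metis
  have spS: "span S = T" using S T(1) by (simp add: span_minimal subset_antisym)
  \<comment> \<open>An arbitrary index is set aside for the transverse vector; the remaining
    \<open>CARD('n) - 1\<close> indices number the basis \<open>S\<close>.\<close>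
  obtain j0 :: 'n where True by blast
  have "finite S" using S(2) independent_imp_finite by blast
  then obtain g where g: "bij_betw g (UNIV - {j0}) S"
    using finite_same_card_bij[of "UNIV - {j0}" S] S(4) T(2) by (auto simp: card_Diff_singleton)
  have "herm w w \<noteq> 0" using w by (simp add: herm_self)
  then have wT: "w \<notin> span S" using Tw spS by blast
  define e where "e = (\<lambda>j. if j = j0 then w else g j)"
  note e = basis_add_line[OF g S(2) wT, folded e_def, unfolded spS]
  obtain C where C: "A ** C = mat 1" "C ** A = mat 1" using A by (auto simp: invertible_def)
  have injA: "inj ((*v) A)"
  proof (rule injI)
    fix x x' assume "A *v x = A *v x'"
    then have "C *v (A *v x) = C *v (A *v x')" by simp
    then show "x = x'" by (simp add: matrix_vector_mul_assoc C)
  qed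
  have g': "bij_betw (\<lambda>j. A *v g j) (UNIV - {j0}) ((*v) A ` S)"
    using bij_betw_trans[OF g inj_on_imp_bij_betw[OF inj_on_subset[OF injA subset_UNIV]]]
    by (simp add: o_def)
  have S': "independent ((*v) A ` S)"
    by (rule linear_independent_injective_image[OF linear_matrix_vector_mult S(2)
          inj_on_subset[OF injA subset_UNIV]])
  have spS': "span ((*v) A ` S) = (*v) A ` T"
    using linear_span_image[OF linear_matrix_vector_mult, of A S] spS by simp
  have yT: "y \<notin> span ((*v) A ` S)"
    unfolding spS' by (rule hermitian_direction_notin_image[OF Tw w A y])
  define f where "f = (\<lambda>j. if j = j0 then y else A *v g j)"
  note f = basis_add_line[OF g' S' yT, folded f_def, unfolded spS']
  define E :: "complex ^ 'n ^ 'n" where "E = (\<chi> i j. e j $ i)"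
  \<comment> \<open>Nondegeneracy of \<open>E\<close> allows the preimage of \<open>y\<close> under
    \<open>A\<close> to be expanded in its columns with complex coefficients
    \<open>c\<close>.\<close>
  have "det E \<noteq> 0"
    unfolding E_def
  proof (rule det_isotropic_basis_nonzero[OF e(1,2)])
    show "kaehler_form x y = 0" if "x \<in> span (range e)" "y \<in> span (range e)" for x y
      using kaehler_form_add_line[OF iso Tw] that unfolding e(3) by blast
  qed
  then obtain E' where "E ** E' = mat 1" by (metis invertible_def invertible_det_nz)
  define u where "u = C *v y"
  define c where "c = E' *v u"
  have Ec: "E *v c = u" by (simp add: c_def matrix_vector_mul_assoc \<open>E ** E' = mat 1\<close>)
  have Au: "A *v u = y" by (simp add: u_def matrix_vector_mul_assoc C)
  \<comment> \<open>With \<open>A\<close> factored out, the new frame differs from \<open>E\<close>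
    only in column \<open>j0\<close>, which becomes \<open>E *v c\<close>; Cramer's lemma evaluates
    that determinant as \<open>c $ j0 * det E\<close>.\<close>
  have "(\<chi> i j. f j $ i) = A ** (\<chi> i j. if j = j0 then (E *v c) $ i else E $ i $ j)"
    unfolding Ec
    by (auto simp: vec_eq_iff matrix_matrix_mult_def f_def E_def e_def Au[symmetric] matrix_vector_mult_def)
  then have 1: "det (\<chi> i j. f j $ i) = det A * (c $ j0 * det E)"
    by (simp add: det_mul cramer_lemma)
  have "herm u w = (\<Sum>j\<in>UNIV. c $ j * herm (e j) w)"
  proof -
    have "herm u w = (\<Sum>i\<in>UNIV. \<Sum>j\<in>UNIV. c $ j * (e j $ i * cnj (w $ i)))"
      by (simp add: Ec[symmetric] herm_def matrix_vector_mult_def E_def sum_distrib_left sum_distrib_right algebra_simps)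
    also have "\<dots> = (\<Sum>j\<in>UNIV. \<Sum>i\<in>UNIV. c $ j * (e j $ i * cnj (w $ i)))"
      by (rule sum.swap)
    finally show ?thesis by (simp add: herm_def sum_distrib_left)
  qed
  \<comment> \<open>All columns other than \<open>j0\<close> lie in \<open>T\<close> and are
    Hermitian orthogonal to \<open>w\<close>.\<close>
  also have "\<dots> = (\<Sum>j\<in>UNIV. if j = j0 then c $ j0 * herm w w else 0)"
    using Tw S(1) g by (intro sum.cong) (auto simp: e_def bij_betw_def)
  finally have "herm u w = c $ j0 * herm w w" by simp
  moreover have "det A * herm u w = herm y y"
    using matrix_image_hermitian_direction[OF y, of u] by (simp add: Au)
  ultimately have "det A * c $ j0 * of_real ((norm w)\<^sup>2) = of_real ((norm y)\<^sup>2)"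
    by (simp add: herm_self mult.assoc)
  then have "det A * c $ j0 = of_real ((norm y)\<^sup>2 / (norm w)\<^sup>2)"
    using w by (simp add: field_simps)
  then have 2: "det (\<chi> i j. f j $ i) = of_real ((norm y)\<^sup>2 / (norm w)\<^sup>2) * det E"
    using 1 by (simp add: mult.assoc[symmetric])
  have "y \<noteq> 0" using yT span_zero by blast
  then have "(norm y)\<^sup>2 / (norm w)\<^sup>2 > 0" using w by simp
  then have "Arg (det (\<chi> i j. f j $ i)) = Arg (det E)"
    unfolding 2 by (rule Arg_times_of_real)
  then show ?thesis
    unfolding lagrangian_angle_eq[OF e] lagrangian_angle_eq[OF f] E_def by simp
qed

text \<open>The derivative of \<open>herm (A s *v v) (A s *v w)\<close> is
  \<open>det (A s) * herm v (B *v w)\<close> plus the conjugate of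
  \<open>det (A s) * herm w (B *v v)\<close>. By the symmetry assumption this is a number plus its
  own conjugate, so the imaginary part is constant and keeps its initial value 0.\<close>

lemma kaehler_form_preserved:
  fixes A A' :: "real \<Rightarrow> complex ^ 'n ^ 'n"
  assumes I: "is_interval I" "0 \<in> I" "s \<in> I"
    and dA: "\<And>s. s \<in> I \<Longrightarrow> (A has_vector_derivative A' s) (at s within I)"
    and eA: "\<And>s. s \<in> I \<Longrightarrow> conj_transpose (A s) ** A' s = (\<chi> i j. cnj (det (A s)) * B $ i $ j)"
    and sym: "herm v (B *v w) = herm w (B *v v)"
    and "A 0 = mat 1" "kaehler_form v w = 0"
  shows "kaehler_form (A s *v v) (A s *v w) = 0"
proof -
  have eA': "conj_transpose (A s) *v (A' s *v x) = cnj (det (A s)) *s (B *v x)" if "s \<in> I" for s x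
    by (simp add: matrix_vector_mul_assoc eA[OF that])
       (simp add: vec_eq_iff matrix_vector_mult_def sum_distrib_left mult.assoc)
  have lin: "bounded_linear (\<lambda>M :: complex ^ 'n ^ 'n. M *v x)" for x
    by (rule bounded_bilinear.bounded_linear_left[OF bounded_bilinear_matrix_vector_mult])
  have d: "((\<lambda>s. kaehler_form (A s *v v) (A s *v w)) has_derivative (\<lambda>h. 0)) (at s within I)"
    if s: "s \<in> I" for s
  proof -
    have "((\<lambda>s. herm (A s *v v) (A s *v w)) has_vector_derivative
        (herm (A s *v v) (A' s *v w) + herm (A' s *v v) (A s *v w))) (at s within I)"
      by (intro bounded_bilinear.has_vector_derivative[OF bounded_bilinear_herm]
          bounded_linear.has_vector_derivative[OF lin] dA s)
    then have "((\<lambda>s. - Im (herm (A s *v v) (A s *v w))) has_vector_derivative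
        - Im (herm (A s *v v) (A' s *v w) + herm (A' s *v v) (A s *v w))) (at s within I)"
      by (intro has_vector_derivative_minus bounded_linear.has_vector_derivative[OF bounded_linear_Im])
    moreover have "herm (A s *v v) (A' s *v w) = det (A s) * herm v (B *v w)"
      by (simp add: herm_adjoint eA'[OF s] herm_smult_right)
    moreover have "herm (A' s *v v) (A s *v w) = cnj (det (A s) * herm w (B *v v))"
      using herm_commute[of "A' s *v v" "A s *v w"]
      by (simp add: herm_adjoint eA'[OF s] herm_smult_right)
    ultimately show ?thesis
      by (simp add: kaehler_form_def has_vector_derivative_def sym)
  qed
  have "convex I" using I(1) by (simp add: is_interval_convex)
  from has_derivative_zero_constant[OF this d]
  obtain c where "\<And>s. s \<in> I \<Longrightarrow> kaehler_form (A s *v v) (A s *v w) = c" by blast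
  then show ?thesis using I assms(7,8) by (metis matrix_vector_mul_lid)
qed

section \<open>Symmetry of second derivatives\<close>

lemma has_derivative_along_segment:
  assumes F: "\<And>x. x \<in> U \<Longrightarrow> (F has_derivative D x) (at x within U)"
    and seg: "\<And>s. s \<in> {0..h} \<Longrightarrow> c + s *\<^sub>R v \<in> U" and s: "s \<in> {0..h}"
  shows "((\<lambda>s. F (c + s *\<^sub>R v)) has_derivative (\<lambda>r. r *\<^sub>R D (c + s *\<^sub>R v) v)) (at s within {0..h})"
proof -
  have 1: "((\<lambda>s. c + s *\<^sub>R v) has_derivative (\<lambda>r. r *\<^sub>R v)) (at s within {0..h})"
    by (auto intro!: derivative_eq_intros)
  have FD: "(F has_derivative D (c + s *\<^sub>R v)) (at (c + s *\<^sub>R v) within U)"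
    using F seg s by blast
  then have "(F has_derivative D (c + s *\<^sub>R v)) (at (c + s *\<^sub>R v) within (\<lambda>s. c + s *\<^sub>R v) ` {0..h})"
    using seg by (auto intro: has_derivative_subset)
  from diff_chain_within[OF 1 this] show ?thesis
    using linear_scale[OF has_derivative_linear[OF FD]] by (simp add: o_def)
qed

text \<open>The mean value theorem is applied twice: along \<open>v\<close> to the difference of
  \<open>f\<close> on two parallel segments offset by \<open>h *\<^sub>R w\<close>, then along
  \<open>w\<close> to the directional derivative \<open>f' _ v\<close>.\<close>

lemma second_difference_mean_value:
  fixes f :: "'a::real_normed_vector \<Rightarrow> real"
  assumes V: "subspace V" "u \<in> V" "v \<in> V" "w \<in> V" and U: "V \<inter> ball u d \<subseteq> U"
    and f: "\<And>x. x \<in> U \<Longrightarrow> (f has_derivative f' x) (at x within U)"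
    and fv: "\<And>x. x \<in> U \<Longrightarrow> ((\<lambda>x. f' x v) has_derivative fv x) (at x within U)"
    and h: "h > 0" "h * (norm v + norm w) < d"
  obtains p where "p \<in> U" "norm (p - u) \<le> h * (norm v + norm w)"
    "f (u + h *\<^sub>R v + h *\<^sub>R w) - f (u + h *\<^sub>R v) - f (u + h *\<^sub>R w) + f u = h * h * fv p w"
proof -
  have close: "norm (s *\<^sub>R v + t *\<^sub>R w) \<le> h * (norm v + norm w)"
    if "s \<in> {0..h}" "t \<in> {0..h}" for s t
  proof -
    have "norm (s *\<^sub>R v + t *\<^sub>R w) \<le> s * norm v + t * norm w"
      using norm_triangle_ineq[of "s *\<^sub>R v" "t *\<^sub>R w"] that by simp
    also have "\<dots> \<le> h * norm v + h * norm w"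
      using that by (intro add_mono mult_right_mono) auto
    finally show ?thesis by (simp add: algebra_simps)
  qed
  have inU: "u + s *\<^sub>R v + t *\<^sub>R w \<in> U" if "s \<in> {0..h}" "t \<in> {0..h}" for s t
  proof -
    have "dist u (u + x) = norm x" for x by (simp add: dist_norm)
    from this[of "s *\<^sub>R v + t *\<^sub>R w"]
    have "dist u (u + s *\<^sub>R v + t *\<^sub>R w) = norm (s *\<^sub>R v + t *\<^sub>R w)"
      by (simp only: add.assoc)
    then have "u + s *\<^sub>R v + t *\<^sub>R w \<in> ball u d"
      using close[OF that] h(2) by simp
    moreover have "u + s *\<^sub>R v + t *\<^sub>R w \<in> V"
      using V by (simp add: subspace_add subspace_scale)
    ultimately show ?thesis using U by blast
  qed
  have 0: "0 \<in> {0..h}" "h \<in> {0..h}" using h by auto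
  have d1: "((\<lambda>s. f (u + h *\<^sub>R w + s *\<^sub>R v) - f (u + s *\<^sub>R v)) has_derivative
      (\<lambda>r. r *\<^sub>R f' (u + h *\<^sub>R w + s *\<^sub>R v) v - r *\<^sub>R f' (u + s *\<^sub>R v) v)) (at s within {0..h})"
    if "0 \<le> s" "s \<le> h" for s
  proof -
    have "u + h *\<^sub>R w + s *\<^sub>R v \<in> U" "u + s *\<^sub>R v \<in> U" if "s \<in> {0..h}" for s
      using inU[OF that 0(1)] inU[OF that 0(2)] by (simp_all add: algebra_simps)
    then show ?thesis
      using that by (intro has_derivative_diff has_derivative_along_segment[OF f]) auto
  qed
  from mvt_simple[OF h(1) d1] obtain \<xi> where \<xi>0: "\<xi> \<in> {0<..<h}"
    and e0: "f (u + h *\<^sub>R w + h *\<^sub>R v) - f (u + h *\<^sub>R v) - (f (u + h *\<^sub>R w + 0 *\<^sub>R v) - f (u + 0 *\<^sub>R v))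
      = (h - 0) *\<^sub>R f' (u + h *\<^sub>R w + \<xi> *\<^sub>R v) v - (h - 0) *\<^sub>R f' (u + \<xi> *\<^sub>R v) v"
    by blast
  have \<xi>: "\<xi> \<in> {0..h}" using \<xi>0 by auto
  have e1: "f (u + h *\<^sub>R w + h *\<^sub>R v) - f (u + h *\<^sub>R v) - (f (u + h *\<^sub>R w) - f u)
      = h * (f' (u + h *\<^sub>R w + \<xi> *\<^sub>R v) v - f' (u + \<xi> *\<^sub>R v) v)"
    using e0 by (simp add: right_diff_distrib)
  have d2: "((\<lambda>t. f' (u + \<xi> *\<^sub>R v + t *\<^sub>R w) v) has_derivative
      (\<lambda>r. r *\<^sub>R fv (u + \<xi> *\<^sub>R v + t *\<^sub>R w) w)) (at t within {0..h})"
    if "0 \<le> t" "t \<le> h" for t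
    using has_derivative_along_segment[OF fv, where c="u + \<xi> *\<^sub>R v" and v=w and s=t and h=h]
      inU[OF \<xi>] that by auto
  from mvt_simple[OF h(1) d2] obtain \<tau> where \<tau>0: "\<tau> \<in> {0<..<h}"
    and e0': "f' (u + \<xi> *\<^sub>R v + h *\<^sub>R w) v - f' (u + \<xi> *\<^sub>R v + 0 *\<^sub>R w) v
      = (h - 0) *\<^sub>R fv (u + \<xi> *\<^sub>R v + \<tau> *\<^sub>R w) w"
    by blast
  have \<tau>: "\<tau> \<in> {0..h}" using \<tau>0 by auto
  have e2: "f' (u + \<xi> *\<^sub>R v + h *\<^sub>R w) v - f' (u + \<xi> *\<^sub>R v) v = h * fv (u + \<xi> *\<^sub>R v + \<tau> *\<^sub>R w) w"
    using e0' by simp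
  show thesis
  proof (rule that[of "u + \<xi> *\<^sub>R v + \<tau> *\<^sub>R w"])
    show "u + \<xi> *\<^sub>R v + \<tau> *\<^sub>R w \<in> U" using inU \<xi> \<tau> by blast
    show "norm (u + \<xi> *\<^sub>R v + \<tau> *\<^sub>R w - u) \<le> h * (norm v + norm w)"
      using close[OF \<xi> \<tau>] by (simp add: add.assoc)
    have "f (u + h *\<^sub>R w + h *\<^sub>R v) = f (u + h *\<^sub>R v + h *\<^sub>R w)"
      and "f' (u + h *\<^sub>R w + \<xi> *\<^sub>R v) v = f' (u + \<xi> *\<^sub>R v + h *\<^sub>R w) v"
      by (simp_all add: algebra_simps)
    moreover from this(2) have "h * (f' (u + h *\<^sub>R w + \<xi> *\<^sub>R v) v - f' (u + \<xi> *\<^sub>R v) v)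
        = h * h * fv (u + \<xi> *\<^sub>R v + \<tau> *\<^sub>R w) w"
      using e2 by (metis mult.assoc)
    ultimately show "f (u + h *\<^sub>R v + h *\<^sub>R w) - f (u + h *\<^sub>R v) - f (u + h *\<^sub>R w) + f u
        = h * h * fv (u + \<xi> *\<^sub>R v + \<tau> *\<^sub>R w) w"
      using e1 by linarith
  qed
qed

text \<open>The second difference is unchanged when \<open>v\<close> and \<open>w\<close> are
  exchanged, so both mixed derivatives take a common value at points close to \<open>u\<close>, and
  continuity carries the equality to \<open>u\<close>.\<close>

lemma second_derivative_symmetric_real:
  fixes f :: "'a::real_normed_vector \<Rightarrow> real"
  assumes V: "subspace V" "v \<in> V" "w \<in> V" and U: "openin (top_of_set V) U" "u \<in> U"
    and f: "\<And>x. x \<in> U \<Longrightarrow> (f has_derivative f' x) (at x within U)"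
    and fv: "\<And>x. x \<in> U \<Longrightarrow> ((\<lambda>x. f' x v) has_derivative fv x) (at x within U)"
    and fw: "\<And>x. x \<in> U \<Longrightarrow> ((\<lambda>x. f' x w) has_derivative fw x) (at x within U)"
    and cont: "continuous_on U (\<lambda>x. fv x w)" "continuous_on U (\<lambda>x. fw x v)"
  shows "fv u w = fw u v"
proof -
  obtain d where d: "d > 0" "V \<inter> ball u d \<subseteq> U"
    using U unfolding openin_contains_ball by (metis Int_commute)
  have uV: "u \<in> V" using U openin_imp_subset by blast
  have "dist (fv u w) (fw u v) < \<eta>" if \<eta>: "\<eta> > 0" for \<eta>
  proof -
    obtain d1 where d1: "d1 > 0" "\<And>x. x \<in> U \<Longrightarrow> dist x u < d1 \<Longrightarrow> dist (fv x w) (fv u w) < \<eta>/2"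
      using cont(1) U(2) \<eta> unfolding continuous_on_iff by (meson half_gt_zero)
    obtain d2 where d2: "d2 > 0" "\<And>x. x \<in> U \<Longrightarrow> dist x u < d2 \<Longrightarrow> dist (fw x v) (fw u v) < \<eta>/2"
      using cont(2) U(2) \<eta> unfolding continuous_on_iff by (meson half_gt_zero)
    define m where "m = min d (min d1 d2)"
    have m: "m > 0" "m \<le> d" "m \<le> d1" "m \<le> d2" using d d1 d2 by (auto simp: m_def)
    define N where "N = norm v + norm w"
    \<comment> \<open>The added 1 keeps the denominator positive when \<open>v\<close> and
      \<open>w\<close> are both zero; \<open>h * N < m\<close> puts both mean value points where the
      continuity estimates hold.\<close>
    define h where "h = m / (N + 1)"
    have "N \<ge> 0" by (simp add: N_def)
    then have h: "h > 0" "h * N < m" using m(1) by (auto simp: h_def field_simps)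
    obtain p where p: "p \<in> U" "norm (p - u) \<le> h * N"
      "f (u + h *\<^sub>R v + h *\<^sub>R w) - f (u + h *\<^sub>R v) - f (u + h *\<^sub>R w) + f u = h * h * fv p w"
      using second_difference_mean_value[OF V(1) uV V(2,3) d(2) f fv h(1)] h(2) m(2)
      unfolding N_def by (smt (verit))
    obtain q where q: "q \<in> U" "norm (q - u) \<le> h * N"
      "f (u + h *\<^sub>R w + h *\<^sub>R v) - f (u + h *\<^sub>R w) - f (u + h *\<^sub>R v) + f u = h * h * fw q v"
      using second_difference_mean_value[OF V(1) uV V(3,2) d(2) f fw h(1)] h(2) m(2)
      unfolding N_def by (smt (verit))
    have "f (u + h *\<^sub>R w + h *\<^sub>R v) = f (u + h *\<^sub>R v + h *\<^sub>R w)" by (simp add: algebra_simps)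
    then have "h * h * fv p w = h * h * fw q v" using p(3) q(3) by linarith
    then have "fv p w = fw q v" using h(1) by simp
    moreover have "dist (fv p w) (fv u w) < \<eta>/2" "dist (fw q v) (fw u v) < \<eta>/2"
      using d1(2)[OF p(1)] d2(2)[OF q(1)] p(2) q(2) h(2) m by (auto simp: dist_norm)
    ultimately show ?thesis by (metis dist_commute dist_triangle_half_r)
  qed
  then show ?thesis by (metis dist_pos_lt less_irrefl)
qed

lemma second_derivative_symmetric:
  fixes f :: "'a::real_normed_vector \<Rightarrow> 'b::euclidean_space"
  assumes V: "subspace V" "v \<in> V" "w \<in> V" and U: "openin (top_of_set V) U" "u \<in> U"
    and f: "\<And>x. x \<in> U \<Longrightarrow> (f has_derivative f' x) (at x within U)"
    and fv: "\<And>x. x \<in> U \<Longrightarrow> ((\<lambda>x. f' x v) has_derivative fv x) (at x within U)"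
    and fw: "\<And>x. x \<in> U \<Longrightarrow> ((\<lambda>x. f' x w) has_derivative fw x) (at x within U)"
    and cont: "continuous_on U (\<lambda>x. fv x w)" "continuous_on U (\<lambda>x. fw x v)"
  shows "fv u w = fw u v"
proof (rule euclidean_eqI)
  fix b :: 'b assume "b \<in> Basis"
  show "fv u w \<bullet> b = fw u v \<bullet> b"
    by (rule second_derivative_symmetric_real[OF V U, where f="\<lambda>x. f x \<bullet> b" and f'="\<lambda>x y. f' x y \<bullet> b"
          and fv="\<lambda>x y. fv x y \<bullet> b" and fw="\<lambda>x y. fw x y \<bullet> b"])
       (auto intro!: has_derivative_inner_left f fv fw continuous_on_inner cont continuous_on_const)
qed

text \<open>Differentiating the orthogonality condition in a chart gives
  \<open>herm (f' u y) (B *v f' u z)\<close> as minus the product of a second derivative of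
  \<open>f\<close> with \<open>B *v f u + b\<close>. That second derivative is symmetric in the two
  directions.\<close>

lemma initial_data_symmetric:
  assumes ini: "initial_data k M X B b" and p: "p \<in> topspace M"
    and v: "v \<in> tangent_space k M X p" and w: "w \<in> tangent_space k M X p"
  shows "herm v (B *v w) = herm w (B *v v)"
proof -
  obtain V U \<phi> u where ch: "local_param k M X V U \<phi>" and op: "openin (top_of_set V) U"
    and u: "u \<in> U" "p = \<phi> u"
    using ini p unfolding initial_data_def immersed_submanifold_def by blast
  define f where "f = X \<circ> \<phi>"
  have V: "subspace V" and sm: "smooth_on U f" and opM: "openin M (\<phi> ` U)"
    using ch by (auto simp: local_param_def f_def)
  have "Ck_on (Suc (Suc 0)) U f" using sm by (simp add: smooth_on_def)
  then obtain f' where f': "\<And>x. x \<in> U \<Longrightarrow> (f has_derivative f' x) (at x within U)"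
    and f'': "\<And>y. Ck_on (Suc 0) U (\<lambda>x. f' x y)"
    unfolding Ck_on.simps(2)[of "Suc 0"] by blast
  have tan: "tangent_space k M X (\<phi> x) = f' x ` V" if "x \<in> U" for x
    using tangent_space_eq_chart[OF ch that] f'[OF that] by (simp add: f_def)
  obtain v' w' where v': "v' \<in> V" "v = f' u v'" and w': "w' \<in> V" "w = f' u w'"
    using v w tan u by auto
  have zero: "herm (f' x y) (B *v f x + b) = 0" if "x \<in> U" "y \<in> V" for x y
  proof -
    have "\<phi> x \<in> topspace M" using that opM openin_subset by blast
    then show ?thesis
      using ini tan[OF that(1)] that(2) by (auto simp: initial_data_def f_def)
  qed
  have lin: "bounded_linear ((*v) B)"
    using linear_matrix_vector_mult linear_conv_bounded_linear by blast
  have eq: "herm (f' u y) (B *v f' u z) = - herm (fy u z) (B *v f u + b)"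
    if fy: "\<And>x. x \<in> U \<Longrightarrow> ((\<lambda>x. f' x y) has_derivative fy x) (at x within U)"
      and y: "y \<in> V" and z: "z \<in> V" for y z fy
  proof -
    have "((\<lambda>x. herm (f' x y) (B *v f x + b)) has_derivative
        (\<lambda>h. herm (f' u y) (B *v f' u h + 0) + herm (fy u h) (B *v f u + b))) (at u within U)"
      by (intro bounded_bilinear.FDERIV[OF bounded_bilinear_herm] has_derivative_add
          bounded_linear.has_derivative[OF lin] has_derivative_const f' fy u)
    moreover have "((\<lambda>x. herm (f' x y) (B *v f x + b)) has_derivative (\<lambda>h. 0)) (at u within U)"
      by (rule has_derivative_transform[OF u(1) _ has_derivative_const[of 0]]) (simp add: zero y)
    \<comment> \<open>The chart is open in \<open>V\<close>; the trivial half-space brings it into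
      the form required by \<open>chart_derivative_unique\<close>.\<close>
    moreover have "openin (top_of_set (V \<inter> {x. 0 \<le> 0 \<bullet> x})) U" using op by simp
    ultimately have "herm (f' u y) (B *v f' u z + 0) + herm (fy u z) (B *v f u + b) = 0"
      using chart_derivative_unique V u(1) z by blast
    then show ?thesis by (simp add: eq_neg_iff_add_eq_0)
  qed
  obtain fv where fv: "\<And>x. x \<in> U \<Longrightarrow> ((\<lambda>x. f' x v') has_derivative fv x) (at x within U)"
    "\<And>y. continuous_on U (\<lambda>x. fv x y)"
    using f''[of v'] by auto
  obtain fw where fw: "\<And>x. x \<in> U \<Longrightarrow> ((\<lambda>x. f' x w') has_derivative fw x) (at x within U)"
    "\<And>y. continuous_on U (\<lambda>x. fw x y)"
    using f''[of w'] by auto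
  have "fv u w' = fw u v'"
    by (rule second_derivative_symmetric[OF V v'(1) w'(1) op u(1) f' fv(1) fw(1) fv(2) fw(2)])
  then show ?thesis
    using eq[OF fv(1) v'(1) w'(1)] eq[OF fw(1) w'(1) v'(1)] v'(2) w'(2) by simp
qed

section \<open>Products with an interval\<close>

lemma second_countable_prod_topology:
  assumes "second_countable X" "second_countable Y"
  shows "second_countable (prod_topology X Y)"
proof -
  obtain \<B> where \<B>: "countable \<B>" "\<And>V. V \<in> \<B> \<Longrightarrow> openin X V"
    "\<And>U x. openin X U \<Longrightarrow> x \<in> U \<Longrightarrow> \<exists>V\<in>\<B>. x \<in> V \<and> V \<subseteq> U"
    using assms(1) unfolding second_countable_def by metis
  obtain \<C> where \<C>: "countable \<C>" "\<And>V. V \<in> \<C> \<Longrightarrow> openin Y V"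
    "\<And>U x. openin Y U \<Longrightarrow> x \<in> U \<Longrightarrow> \<exists>V\<in>\<C>. x \<in> V \<and> V \<subseteq> U"
    using assms(2) unfolding second_countable_def by metis
  show ?thesis
    unfolding second_countable_def
  proof (intro exI[of _ "(\<lambda>(U, V). U \<times> V) ` (\<B> \<times> \<C>)"] conjI ballI allI impI)
    show "countable ((\<lambda>(U, V). U \<times> V) ` (\<B> \<times> \<C>))" using \<B>(1) \<C>(1) by blast
    show "openin (prod_topology X Y) W" if "W \<in> (\<lambda>(U, V). U \<times> V) ` (\<B> \<times> \<C>)" for W
      using that \<B>(2) \<C>(2) by (auto simp: openin_prod_Times_iff)
    fix W z assume W: "openin (prod_topology X Y) W \<and> z \<in> W"
    obtain x y where z: "z = (x, y)" by (cases z)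
    obtain U V where UV: "openin X U" "openin Y V" "x \<in> U" "y \<in> V" "U \<times> V \<subseteq> W"
      using W z unfolding openin_prod_topology_alt by blast
    obtain U' where "U' \<in> \<B>" "x \<in> U'" "U' \<subseteq> U" using \<B>(3) UV by blast
    moreover obtain V' where "V' \<in> \<C>" "y \<in> V'" "V' \<subseteq> V" using \<C>(3) UV by blast
    ultimately show "\<exists>W'\<in>(\<lambda>(U, V). U \<times> V) ` (\<B> \<times> \<C>). z \<in> W' \<and> W' \<subseteq> W"
      using UV(5) z by (intro bexI[of _ "U' \<times> V'"]) auto
  qed
qed

lemma second_countable_euclidean:
  "second_countable (euclidean :: 'a::second_countable_topology topology)"
proof -
  obtain \<B> :: "'a set set" where \<B>: "countable \<B>" "\<And>C. C \<in> \<B> \<Longrightarrow> open C"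
    "\<And>S. open S \<Longrightarrow> \<exists>U. U \<subseteq> \<B> \<and> S = \<Union>U"
    using univ_second_countable by blast
  show ?thesis
    unfolding second_countable_def
  proof (intro exI[of _ \<B>] conjI ballI allI impI)
    fix U and x :: 'a assume "openin euclidean U \<and> x \<in> U"
    then obtain \<U> where "\<U> \<subseteq> \<B>" "U = \<Union>\<U>" "x \<in> U" using \<B>(3) by auto
    then show "\<exists>V\<in>\<B>. x \<in> V \<and> V \<subseteq> U" by blast
  qed (use \<B> in auto)
qed

text \<open>A chart domain may be cut off by one half-space only, so an interval with two endpoints
  is covered by pieces that each keep at most one of them. The pair \<sigma>, \<open>c\<close>
  describes the half-line, with zeros for the full line.\<close>

lemma interval_half_line_nbhd:
  fixes I :: "real set"
  assumes I: "is_interval I" and s: "s \<in> I" and t: "t \<in> I" "t \<noteq> s"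
  obtains J \<sigma> c where "s \<in> J" "openin (top_of_set I) J" "openin (top_of_set {x. c \<le> \<sigma> * x}) J"
proof -
  have conv: "x \<in> I" if "y \<in> I" "z \<in> I" "y \<le> x" "x \<le> z" for x y z
    using I that unfolding is_interval_1 by blast
  show thesis
  proof (cases "\<exists>s1\<in>I. s < s1")
    case True
    then obtain s1 where s1: "s1 \<in> I" "s < s1" by blast
    \<comment> \<open>Cutting above \<open>s\<close> discards any upper endpoint; the two cases
      below ask whether a least element remains.\<close>
    define J where "J = I \<inter> {..<s1}"
    have J: "s \<in> J" "openin (top_of_set I) J" using s s1 by (auto simp: J_def)
    have mem: "x \<in> J" if "y \<in> I" "y \<le> x" "x < s1" for x y
      using conv[OF that(1) s1(1) that(2)] that(3) by (simp add: J_def)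
    show thesis
    proof (cases "\<exists>m\<in>I. \<forall>x\<in>I. m \<le> x")
      case True
      then obtain m where m: "m \<in> I" "\<And>x. x \<in> I \<Longrightarrow> m \<le> x" by blast
      have "J = {x. m \<le> 1 * x} \<inter> {..<s1}"
        using m(2) mem[OF m(1)] by (auto simp: J_def)
      then have "openin (top_of_set {x. m \<le> 1 * x}) J" by (simp only: openin_open_Int open_lessThan)
      then show thesis by (rule that[OF J])
    next
      case False
      have "open J"
      proof (subst open_subopen, intro ballI)
        fix x assume x: "x \<in> J"
        then obtain y where y: "y \<in> I" "y < x" using False by (force simp: J_def not_le)
        have "{y<..<s1} \<subseteq> J" using mem[OF y(1)] by auto
        moreover have "x \<in> {y<..<s1}" using x y by (auto simp: J_def)
        ultimately show "\<exists>T. open T \<and> x \<in> T \<and> T \<subseteq> J"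
          by (intro exI[of _ "{y<..<s1}"]) simp
      qed
      then have "openin (top_of_set {x. 0 \<le> 0 * x}) J" by simp
      then show thesis by (rule that[OF J])
    qed
  next
    case False
    then have le: "\<And>x. x \<in> I \<Longrightarrow> x \<le> s" by (meson not_le)
    have "t < s" using le t by force
    \<comment> \<open>Here \<open>s\<close> is the greatest element of \<open>I\<close>, and cutting
      at \<open>t < s\<close> discards any lower endpoint.\<close>
    define J where "J = I \<inter> {t<..}"
    have "J = {x. - s \<le> -1 * x} \<inter> {t<..}"
      using conv[OF t(1) s] le by (auto simp: J_def)
    then have "openin (top_of_set {x. - s \<le> -1 * x}) J" by (simp only: openin_open_Int open_greaterThan)
    moreover have J: "s \<in> J" "openin (top_of_set I) J" using s \<open>t < s\<close> by (auto simp: J_def)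
    ultimately show thesis by (intro that[OF J])
  qed
qed

text \<open>The time axis is realized inside the same Euclidean space as the line through a unit
  vector \<open>e\<close> orthogonal to \<open>V\<close>: the coordinate
  \<open>e \<bullet> y\<close> is the time, and \<open>P y\<close> is the parameter in the given
  chart. The half-line around the time value becomes a half-space with normal
  \<sigma>\<open>*\<^sub>R e\<close>.\<close>

lemma product_chart:
  fixes V :: "'e::euclidean_space set"
  assumes V: "subspace V" and U: "openin (top_of_set V) U"
    and \<phi>: "openin M (\<phi> ` U)" "homeomorphic_map (top_of_set U) (subtopology M (\<phi> ` U)) \<phi>"
    and e: "norm e = 1" "\<And>x. x \<in> V \<Longrightarrow> e \<bullet> x = 0"
    and J: "openin (top_of_set I) J" "openin (top_of_set {s. c \<le> \<sigma> * s}) J"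
  defines "P \<equiv> \<lambda>y. y - (e \<bullet> y) *\<^sub>R e"
  defines "V' \<equiv> {y. P y \<in> V}" and "U' \<equiv> {y. P y \<in> U \<and> e \<bullet> y \<in> J}"
    and "\<Phi> \<equiv> \<lambda>y. (e \<bullet> y, \<phi> (P y))"
  shows "subspace V'" "dim V' = Suc (dim V)"
    "openin (top_of_set (V' \<inter> {x. c \<le> (\<sigma> *\<^sub>R e) \<bullet> x})) U'"
    "openin (prod_topology (top_of_set I) M) (\<Phi> ` U')"
    "homeomorphic_map (top_of_set U') (subtopology (prod_topology (top_of_set I) M) (\<Phi> ` U')) \<Phi>"
    "\<Phi> ` U' = J \<times> \<phi> ` U"
proof -
  have ee: "e \<bullet> e = 1" using e(1) by (simp add: norm_eq_1)
  have linP: "linear P"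
    by (auto intro!: linearI simp: P_def algebra_simps)
  then show sub: "subspace V'"
    using V linear_subspace_vimage unfolding V'_def vimage_def by blast
  have UV: "U \<subseteq> V" using U openin_imp_subset by blast
  have P: "P (x + s *\<^sub>R e) = x" "e \<bullet> (x + s *\<^sub>R e) = s" if "x \<in> V" for x s
    using e(2)[OF that] ee by (simp_all add: P_def inner_add_right)
  have Py: "P y + (e \<bullet> y) *\<^sub>R e = y" for y by (simp add: P_def)
  have spV: "span V = V" using V by (simp add: span_eq_iff)
  have "V' = span (insert e V)"
  proof
    show "V' \<subseteq> span (insert e V)"
      unfolding V'_def span_insert P_def spV by auto
    show "span (insert e V) \<subseteq> V'"
    proof (rule span_minimal[OF _ sub])
      show "insert e V \<subseteq> V'"
        using P(1)[of 0 1] P(1)[of _ 0] V by (auto simp: V'_def subspace_0)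
    qed
  qed
  moreover have "e \<notin> span V" using e(2)[of e] ee unfolding spV by auto
  ultimately show "dim V' = Suc (dim V)" by (simp add: dim_insert)
  show "openin (top_of_set (V' \<inter> {x. c \<le> (\<sigma> *\<^sub>R e) \<bullet> x})) U'"
  proof -
    obtain S where S: "open S" "U = V \<inter> S" using U by (auto simp: openin_open)
    obtain R where R: "open R" "J = {s. c \<le> \<sigma> * s} \<inter> R" using J(2) by (auto simp: openin_open)
    have "U' = (V' \<inter> {x. c \<le> (\<sigma> *\<^sub>R e) \<bullet> x}) \<inter> (P -` S \<inter> (\<bullet>) e -` R)"
      by (auto simp: U'_def V'_def S(2) R(2))
    moreover have "open (P -` S \<inter> (\<bullet>) e -` R)"
      using linP S(1) R(1)
      by (intro open_Int open_vimage linear_continuous_on continuous_intros)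
         (auto simp: linear_conv_bounded_linear)
    ultimately show ?thesis by (metis openin_open_Int)
  qed
  show im: "\<Phi> ` U' = J \<times> \<phi> ` U"
  proof
    show "\<Phi> ` U' \<subseteq> J \<times> \<phi> ` U" by (auto simp: \<Phi>_def U'_def)
    show "J \<times> \<phi> ` U \<subseteq> \<Phi> ` U'"
    proof
      fix z assume "z \<in> J \<times> \<phi> ` U"
      then obtain s x where z: "z = (s, \<phi> x)" "s \<in> J" "x \<in> U" by blast
      then have "x + s *\<^sub>R e \<in> U'" "\<Phi> (x + s *\<^sub>R e) = z"
        using P[of x s] UV by (auto simp: U'_def \<Phi>_def)
      then show "z \<in> \<Phi> ` U'" by blast
    qed
  qed
  show "openin (prod_topology (top_of_set I) M) (\<Phi> ` U')"
    unfolding im using J(1) \<phi>(1) by (simp add: openin_prod_Times_iff)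
  obtain \<phi>i where \<phi>i: "homeomorphic_maps (top_of_set U) (subtopology M (\<phi> ` U)) \<phi> \<phi>i"
    using \<phi>(2) unfolding homeomorphic_map_maps by blast
  have contP: "continuous_on S P" for S
    using linP by (simp add: linear_continuous_on linear_conv_bounded_linear)
  \<comment> \<open>The chart factors through the product of \<open>J\<close> and \<open>U\<close>:
    first the linear splitting along \<open>e\<close>, then the identity times \<phi>.\<close>
  have "homeomorphic_maps (top_of_set U') (top_of_set (J \<times> U)) (\<lambda>y. (e \<bullet> y, P y)) (\<lambda>z. snd z + fst z *\<^sub>R e)"
    unfolding homeomorphic_maps_def
  proof (intro conjI ballI)
    show "continuous_map (top_of_set U') (top_of_set (J \<times> U)) (\<lambda>y. (e \<bullet> y, P y))"
      by (auto simp: U'_def intro!: continuous_intros contP)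
    show "continuous_map (top_of_set (J \<times> U)) (top_of_set U') (\<lambda>z. snd z + fst z *\<^sub>R e)"
      using P UV by (auto simp: U'_def intro!: continuous_intros)
  qed (use Py P UV in \<open>auto simp: add.commute\<close>)
  moreover have "homeomorphic_maps (top_of_set (J \<times> U)) (prod_topology (top_of_set J) (subtopology M (\<phi> ` U)))
      (\<lambda>(s, x). (id s, \<phi> x)) (\<lambda>(s, x). (id s, \<phi>i x))"
    unfolding prod_topology_subtopology_eu[symmetric] homeomorphic_maps_prod
    using \<phi>i by (simp add: homeomorphic_maps_def)
  ultimately have "homeomorphic_map (top_of_set U') (prod_topology (top_of_set J) (subtopology M (\<phi> ` U)))
      ((\<lambda>(s, x). (id s, \<phi> x)) \<circ> (\<lambda>y. (e \<bullet> y, P y)))"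
    using homeomorphic_maps_compose homeomorphic_maps_map by blast
  moreover have "(\<lambda>(s, x). (id s, \<phi> x)) \<circ> (\<lambda>y. (e \<bullet> y, P y)) = \<Phi>"
    by (auto simp: \<Phi>_def)
  moreover have "J \<subseteq> I" using J(1) openin_imp_subset by blast
  then have "subtopology (prod_topology (top_of_set I) M) (J \<times> \<phi> ` U)
      = prod_topology (top_of_set J) (subtopology M (\<phi> ` U))"
    by (simp add: subtopology_Times subtopology_subtopology Int_absorb1)
  ultimately show "homeomorphic_map (top_of_set U') (subtopology (prod_topology (top_of_set I) M) (\<Phi> ` U')) \<Phi>"
    unfolding im by simp
qed

section \<open>The swept-out submanifold\<close>

lemma tangent_space_subspace_dim:
  fixes X :: "'p \<Rightarrow> 'e::euclidean_space"
  assumes "immersed_submanifold k M X" "p \<in> topspace M"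
  shows "subspace (tangent_space k M X p)" "dim (tangent_space k M X p) = k"
proof -
  obtain V U \<phi> u where ch: "local_param k M X V U \<phi>" and u: "u \<in> U" "p = \<phi> u"
    using assms unfolding immersed_submanifold_def by blast
  have "Ck_on (Suc 0) U (X \<circ> \<phi>)" using ch by (simp add: local_param_def smooth_on_def)
  then obtain D where D: "((X \<circ> \<phi>) has_derivative D) (at u within U)" using u(1) by auto
  have T: "tangent_space k M X p = D ` V" using tangent_space_eq_chart[OF ch u(1) D] u(2) by simp
  have V: "subspace V" "dim V = k" "inj_on D V" using ch u D by (auto simp: local_param_def)
  have lin: "linear D" using D has_derivative_linear by blast
  show "subspace (tangent_space k M X p)"
    unfolding T by (rule linear_subspace_image[OF lin V(1)])
  have "span V = V" using V(1) by (simp add: span_eq_iff)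
  then show "dim (tangent_space k M X p) = k"
    unfolding T using dim_image_eq[OF lin, of V] V(2,3) by metis
qed

text \<open>The velocity of the moving point solves the equation that relates \<open>y\<close> to
  \<open>w\<close> in the lemmas on transport, with \<open>w = B *v x + b\<close>.\<close>

lemma conj_transpose_velocity:
  fixes A A' B :: "complex ^ 'n ^ 'n"
  assumes "conj_transpose A ** A' = (\<chi> i j. cnj (det A) * B $ i $ j)"
    and "conj_transpose A *v a' = cnj (det A) *s b"
  shows "conj_transpose A *v (A' *v x + a') = cnj (det A) *s (B *v x + b)"
proof -
  have "conj_transpose A *v (A' *v x) = cnj (det A) *s (B *v x)"
    by (simp add: matrix_vector_mul_assoc assms(1))
       (simp add: vec_eq_iff matrix_vector_mult_def sum_distrib_left mult.assoc)
  then show ?thesis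
    by (simp add: matrix_vector_right_distrib assms(2) vector_add_ldistrib)
qed

text \<open>In the product chart the derivative of the sweep is the image under \<open>A s\<close>
  of the derivative along \<Sigma> plus a multiple of the velocity. The velocity lies outside the
  image of the tangent space, so this derivative is injective, and its range is the asserted tangent
  space.\<close>

lemma sweep_chart:
  fixes M :: "'p topology" and X :: "'p \<Rightarrow> complex ^ 'n"
    and B :: "complex ^ 'n ^ 'n" and A A' :: "real \<Rightarrow> complex ^ 'n ^ 'n" and a a' :: "real \<Rightarrow> complex ^ 'n"
  assumes ini: "initial_data (CARD('n) - 1) M X B b"
    and nz: "\<And>p. p \<in> topspace M \<Longrightarrow> B *v X p + b \<noteq> 0"
    and I: "is_interval I" "t \<in> I" "t \<noteq> s"
    and inv: "\<And>s. s \<in> I \<Longrightarrow> invertible (A s)"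
    and dA: "\<And>s. s \<in> I \<Longrightarrow> (A has_vector_derivative A' s) (at s within I)"
    and da: "\<And>s. s \<in> I \<Longrightarrow> (a has_vector_derivative a' s) (at s within I)"
    and eA: "\<And>s. s \<in> I \<Longrightarrow> conj_transpose (A s) ** A' s = (\<chi> i j. cnj (det (A s)) * B $ i $ j)"
    and ea: "\<And>s. s \<in> I \<Longrightarrow> conj_transpose (A s) *v a' s = cnj (det (A s)) *s b"
    and s: "s \<in> I" and p: "p \<in> topspace M"
  defines "F \<equiv> \<lambda>(s, p). A s *v X p + a s" and "N \<equiv> prod_topology (top_of_set I) M"
  obtains V U \<phi> where "local_param CARD('n) N F V U \<phi>" "(s, p) \<in> \<phi> ` U"
    "tangent_space CARD('n) N F (s, p) =
       {v + r *\<^sub>R (A' s *v X p + a' s) | v r. v \<in> (*v) (A s) ` tangent_space (CARD('n) - 1) M X p}"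
proof -
  obtain V U \<phi> u where ch: "local_param (CARD('n) - 1) M X V U \<phi>" and op: "openin (top_of_set V) U"
    and u: "u \<in> U" "p = \<phi> u"
    using ini p unfolding initial_data_def immersed_submanifold_def by blast
  have V: "subspace V" "dim V = CARD('n) - 1" and sm: "smooth_on U (X \<circ> \<phi>)"
    and \<phi>: "openin M (\<phi> ` U)" "homeomorphic_map (top_of_set U) (subtopology M (\<phi> ` U)) \<phi>"
    using ch by (auto simp: local_param_def)
  have UV: "U \<subseteq> V" using op openin_imp_subset by blast
  have C0: "CARD('n) > 0" by simp
  \<comment> \<open>The real dimension is twice \<open>CARD('n)\<close>, which leaves room for a
    direction orthogonal to \<open>V\<close> to carry the time.\<close>
  have "DIM(complex ^ 'n) = CARD('n) * 2" by simp
  then have "dim V < DIM(complex ^ 'n)" using V(2) C0 by linarith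
  then obtain e0 where e0: "e0 \<noteq> 0" "\<And>y. y \<in> span V \<Longrightarrow> orthogonal e0 y"
    using orthogonal_to_subspace_exists by blast
  define e where "e = (1 / norm e0) *\<^sub>R e0"
  have e: "norm e = 1" "\<And>x. x \<in> V \<Longrightarrow> e \<bullet> x = 0"
    using e0 by (auto simp: e_def orthogonal_def span_base)
  obtain J \<sigma> c where J: "s \<in> J" "openin (top_of_set I) J" "openin (top_of_set {x. c \<le> \<sigma> * x}) J"
    by (rule interval_half_line_nbhd[OF I(1) s I(2,3)])
  have JI: "J \<subseteq> I" by (rule openin_imp_subset[OF J(2)])
  define P where "P = (\<lambda>y. y - (e \<bullet> y) *\<^sub>R e)"
  define V' where "V' = {y. P y \<in> V}"
  define U' where "U' = {y. P y \<in> U \<and> e \<bullet> y \<in> J}"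
  define \<Phi> where "\<Phi> = (\<lambda>y. (e \<bullet> y, \<phi> (P y)))"
  have pc: "subspace V'" "dim V' = Suc (dim V)"
    "openin (top_of_set (V' \<inter> {x. c \<le> (\<sigma> *\<^sub>R e) \<bullet> x})) U'"
    "openin N (\<Phi> ` U')" "homeomorphic_map (top_of_set U') (subtopology N (\<Phi> ` U')) \<Phi>"
    unfolding V'_def U'_def \<Phi>_def P_def N_def
    by (rule product_chart[OF V(1) op \<phi> e J(2,3)], assumption)+
  have blP: "bounded_linear P"
    by (auto intro!: linearI simp: linear_conv_bounded_linear[symmetric] P_def algebra_simps)
  have ble: "bounded_linear ((\<bullet>) e)" by (rule bounded_linear_inner_right)
  have PU: "P ` U' \<subseteq> U" and eU: "(\<bullet>) e ` U' \<subseteq> I" using JI by (auto simp: U'_def)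
  have F\<Phi>: "F \<circ> \<Phi> = (\<lambda>y. A (e \<bullet> y) *v (X \<circ> \<phi>) (P y) + a (e \<bullet> y))"
    by (auto simp: F_def \<Phi>_def)
  have smooth: "smooth_on U' (F \<circ> \<Phi>)"
    unfolding smooth_on_def F\<Phi>
  proof
    fix k
    have "Ck_on k I A" "Ck_on k I a" using smooth_solution[OF inv dA da eA ea] by blast+
    moreover have "Ck_on k U (X \<circ> \<phi>)" using sm by (simp add: smooth_on_def)
    ultimately show "Ck_on k U' (\<lambda>y. A (e \<bullet> y) *v (X \<circ> \<phi>) (P y) + a (e \<bullet> y))"
      by (intro Ck_on_add Ck_on_bounded_bilinear[OF bounded_bilinear_matrix_vector_mult]
          Ck_on_compose_linear[OF ble eU] Ck_on_compose_linear[OF blP PU])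
  qed
  have "Ck_on (Suc 0) U (X \<circ> \<phi>)" using sm by (simp add: smooth_on_def)
  then obtain D where D: "\<And>x. x \<in> U \<Longrightarrow> ((X \<circ> \<phi>) has_derivative D x) (at x within U)" by auto
  have tan: "tangent_space (CARD('n) - 1) M X (\<phi> x) = D x ` V" if "x \<in> U" for x
    by (rule tangent_space_eq_chart[OF ch that D[OF that]])
  define Y where "Y = (\<lambda>y. A' (e \<bullet> y) *v X (\<phi> (P y)) + a' (e \<bullet> y))"
  define E where "E = (\<lambda>y h. A (e \<bullet> y) *v D (P y) (P h) + (e \<bullet> h) *\<^sub>R Y y)"
  have E: "((F \<circ> \<Phi>) has_derivative E y) (at y within U')" if y: "y \<in> U'" for y
  proof -
    have yI: "e \<bullet> y \<in> I" "P y \<in> U" using y JI by (auto simp: U'_def)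
    have "((\<lambda>y. A (e \<bullet> y) *v (X \<circ> \<phi>) (P y) + a (e \<bullet> y)) has_derivative
        (\<lambda>h. (A (e \<bullet> y) *v D (P y) (P h) + ((e \<bullet> h) *\<^sub>R A' (e \<bullet> y)) *v (X \<circ> \<phi>) (P y)) + (e \<bullet> h) *\<^sub>R a' (e \<bullet> y)))
        (at y within U')"
      using has_derivative_compose_linear[OF blP PU D[OF yI(2)]]
        has_derivative_compose_linear[OF ble eU dA[OF yI(1), unfolded has_vector_derivative_def]]
        has_derivative_compose_linear[OF ble eU da[OF yI(1), unfolded has_vector_derivative_def]]
      by (intro has_derivative_add bounded_bilinear.FDERIV[OF bounded_bilinear_matrix_vector_mult])
    then show ?thesis
      unfolding F\<Phi> by (simp add: E_def Y_def matrix_vector_scaleR_left scaleR_add_right add.assoc)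
  qed
  have inj: "inj_on G V'" if y: "y \<in> U'" and G: "((F \<circ> \<Phi>) has_derivative G) (at y within U')" for y G
  proof -
    \<comment> \<open>The immersion condition concerns every derivative \<open>G\<close> within
      \<open>U'\<close>; on \<open>V'\<close> each of them agrees with the explicit
      \<open>E y\<close>.\<close>
    have GE: "G h = E y h" if "h \<in> V'" for h
      by (rule chart_derivative_unique[OF pc(3) pc(1) y that G E[OF y]])
    have yI: "e \<bullet> y \<in> I" "P y \<in> U" using y JI by (auto simp: U'_def)
    have top: "\<phi> (P y) \<in> topspace M" using yI(2) \<phi>(1) openin_subset by blast
    let ?T = "D (P y) ` V"
    have Tw: "herm x (B *v X (\<phi> (P y)) + b) = 0" if "x \<in> ?T" for x
      using ini top that tan[OF yI(2)] by (auto simp: initial_data_def)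
    have Y: "Y y \<notin> (*v) (A (e \<bullet> y)) ` ?T"
      using hermitian_direction_notin_image[OF Tw nz[OF top] inv[OF yI(1)]]
        conj_transpose_velocity[OF eA[OF yI(1)] ea[OF yI(1)], of "X (\<phi> (P y))"]
      unfolding Y_def by blast
    have linD: "linear (D (P y))" using D[OF yI(2)] has_derivative_linear by blast
    have "h = 0" if h: "h \<in> V'" "G h = 0" for h
    proof -
      have Ph: "P h \<in> V" using h by (simp add: V'_def)
      have eq: "A (e \<bullet> y) *v D (P y) (P h) + (e \<bullet> h) *\<^sub>R Y y = 0"
        using h GE by (simp add: E_def)
      \<comment> \<open>A nonzero time component would let the velocity be solved for as an element
        of the image of the tangent space.\<close>
      have r: "e \<bullet> h = 0"
      proof (rule ccontr)
        assume r: "e \<bullet> h \<noteq> 0"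
        have "(e \<bullet> h) *\<^sub>R Y y = - (A (e \<bullet> y) *v D (P y) (P h))"
          using eq by (metis add.commute eq_neg_iff_add_eq_0)
        then have "Y y = (- 1 / (e \<bullet> h)) *\<^sub>R (A (e \<bullet> y) *v D (P y) (P h))"
          using r by (metis (no_types, lifting) divide_minus_left real_vector.scale_minus_left
              real_vector.scale_minus_right real_vector.scale_one real_vector.scale_scale
              nonzero_eq_divide_eq mult.commute)
        also have "\<dots> = A (e \<bullet> y) *v D (P y) ((- 1 / (e \<bullet> h)) *\<^sub>R P h)"
          by (simp only: matrix_vector_scaleR_right linear_scale[OF linD])
        finally show False
          using Y subspace_scale[OF V(1) Ph] by blast
      qed
      then have "A (e \<bullet> y) *v D (P y) (P h) = 0" using eq by simp
      then have "D (P y) (P h) = 0"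
        using inv[OF yI(1)] unfolding invertible_left_inverse matrix_left_invertible_ker by blast
      moreover have "inj_on (D (P y)) V"
        using ch D[OF yI(2)] yI(2) by (auto simp: local_param_def)
      ultimately have "P h = 0"
        using Ph subspace_0[OF V(1)] linear_0[OF linD] by (metis inj_onD)
      then show "h = 0" using r by (simp add: P_def)
    qed
    moreover have linG: "linear G" using G has_derivative_linear by blast
    ultimately show ?thesis
      using linear_injective_on_subspace_0[OF linG pc(1)] by blast
  qed
  have "dim V' = CARD('n)" using pc(2) V(2) C0 by simp
  then have lp: "local_param CARD('n) N F V' U' \<Phi>"
    unfolding local_param_def using pc(1,3,4,5) smooth inj by blast
  \<comment> \<open>This is the parameter over \<open>(s, p)\<close>: the parameter \<open>u\<close>
    of \<open>p\<close>, shifted by the time \<open>s\<close> along \<open>e\<close>.\<close>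
  define y0 where "y0 = u + s *\<^sub>R e"
  have ee: "e \<bullet> e = 1" using e(1) by (simp add: norm_eq_1)
  have eu: "e \<bullet> u = 0" using e(2) u(1) UV by blast
  have y0: "e \<bullet> y0 = s" "P y0 = u" using ee eu by (simp_all add: y0_def P_def inner_add_right)
  have y0U: "y0 \<in> U'" and \<Phi>y0: "\<Phi> y0 = (s, p)" using y0 u J(1) by (auto simp: U'_def \<Phi>_def)
  have "tangent_space CARD('n) N F (s, p) = E y0 ` V'"
    using tangent_space_eq_chart[OF lp y0U E[OF y0U]] \<Phi>y0 by simp
  also have "\<dots> = {v + r *\<^sub>R (A' s *v X p + a' s) | v r. v \<in> (*v) (A s) ` tangent_space (CARD('n) - 1) M X p}"
    (is "_ = ?R")
  proof -
    have Ey0: "E y0 h = A s *v D u (P h) + (e \<bullet> h) *\<^sub>R (A' s *v X p + a' s)" for h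
      by (simp add: E_def Y_def y0 u(2))
    have Tp: "tangent_space (CARD('n) - 1) M X p = D u ` V" using tan u by simp
    show ?thesis
    proof
      show "E y0 ` V' \<subseteq> ?R" unfolding Tp by (auto simp: Ey0 V'_def)
      show "?R \<subseteq> E y0 ` V'"
      proof
        fix z assume "z \<in> ?R"
        then obtain x r where x: "x \<in> V" "z = A s *v D u x + r *\<^sub>R (A' s *v X p + a' s)"
          unfolding Tp by blast
        have "P (x + r *\<^sub>R e) = x" "e \<bullet> (x + r *\<^sub>R e) = r"
          using e(2)[OF x(1)] ee by (simp_all add: P_def inner_add_right)
        then have "x + r *\<^sub>R e \<in> V'" "E y0 (x + r *\<^sub>R e) = z"
          using x by (simp_all add: V'_def Ey0)
        then show "z \<in> E y0 ` V'" by blast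
      qed
    qed
  qed
  finally show thesis using that[OF lp] y0U \<Phi>y0 by (metis imageI)
qed

text \<open>The interval may contain endpoints, whence the product is treated as a manifold with
  boundary. The condition \<open>I \<noteq> {0}\<close> gives the time direction positive length, so
  that the product has dimension \<open>CARD('n)\<close>.\<close>

theorem theorem5:
  fixes \<Sigma> :: "'p topology" and X :: "'p \<Rightarrow> complex ^ 'n"
    and B :: "complex ^ 'n ^ 'n" and b :: "complex ^ 'n"
    and I :: "real set"
    and A A' :: "real \<Rightarrow> complex ^ 'n ^ 'n" and a a' :: "real \<Rightarrow> complex ^ 'n"
  assumes "immersed_submanifold (CARD('n) - 1) \<Sigma> X"
    and "isotropic (CARD('n) - 1) \<Sigma> X"
    and "invertible B"
    and "initial_data_const_angle \<Sigma> X B b"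
    and "is_interval I" and "0 \<in> I" and "I \<noteq> {0}"
    and "\<And>s. s \<in> I \<Longrightarrow> invertible (A s)"
    and "\<And>s. s \<in> I \<Longrightarrow> (A has_vector_derivative A' s) (at s within I)"
    and "\<And>s. s \<in> I \<Longrightarrow> (a has_vector_derivative a' s) (at s within I)"
    and "\<And>s. s \<in> I \<Longrightarrow> conj_transpose (A s) ** A' s = (\<chi> i j. cnj (det (A s)) * B $ i $ j)"
    and "\<And>s. s \<in> I \<Longrightarrow> conj_transpose (A s) *v a' s = cnj (det (A s)) *s b"
    and "A 0 = mat 1" and "a 0 = 0"
  shows "special_lagrangian (prod_topology (top_of_set I) \<Sigma>) (\<lambda>(s, p). A s *v X p + a s)"
proof -
  let ?N = "prod_topology (top_of_set I) \<Sigma>" and ?F = "\<lambda>(s, p). A s *v X p + a s"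
  let ?T = "tangent_space (CARD('n) - 1) \<Sigma> X"
  have ini: "initial_data (CARD('n) - 1) \<Sigma> X B b"
    and nz: "\<And>p. p \<in> topspace \<Sigma> \<Longrightarrow> B *v X p + b \<noteq> 0"
    using assms(4) by (auto simp: initial_data_const_angle_def)
  obtain \<Theta> where \<Theta>: "\<And>p. p \<in> topspace \<Sigma> \<Longrightarrow>
      lagrangian_angle {v + r *\<^sub>R (B *v X p + b) | v r. v \<in> ?T p} = \<Theta>"
    using assms(4) unfolding initial_data_const_angle_def by blast
  obtain t0 where t0: "t0 \<in> I" "t0 \<noteq> 0" using assms(6,7) by blast
  have chart: "\<exists>V U \<phi>. local_param CARD('n) ?N ?F V U \<phi> \<and> (s, p) \<in> \<phi> ` U"
    and tan: "tangent_space CARD('n) ?N ?F (s, p) = {v + r *\<^sub>R (A' s *v X p + a' s) | v r. v \<in> (*v) (A s) ` ?T p}"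
    if s: "s \<in> I" and p: "p \<in> topspace \<Sigma>" for s p
  proof -
    \<comment> \<open>One of 0 and \<open>t0\<close> differs from \<open>s\<close>.\<close>
    obtain t where t: "t \<in> I" "t \<noteq> s" using t0 assms(6) by metis
    obtain V U \<phi> where "local_param CARD('n) ?N ?F V U \<phi>" "(s, p) \<in> \<phi> ` U"
      and T: "tangent_space CARD('n) ?N ?F (s, p) = {v + r *\<^sub>R (A' s *v X p + a' s) | v r. v \<in> (*v) (A s) ` ?T p}"
      by (rule sweep_chart[OF ini nz assms(5) t assms(8-12) s p])
    then show "\<exists>V U \<phi>. local_param CARD('n) ?N ?F V U \<phi> \<and> (s, p) \<in> \<phi> ` U" by blast
    show "tangent_space CARD('n) ?N ?F (s, p) = {v + r *\<^sub>R (A' s *v X p + a' s) | v r. v \<in> (*v) (A s) ` ?T p}"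
      by (rule T)
  qed
  have Tw: "herm v (B *v X p + b) = 0" if "p \<in> topspace \<Sigma>" "v \<in> ?T p" for p v
    using ini that by (simp add: initial_data_def)
  have iso0: "kaehler_form v w = 0" if "p \<in> topspace \<Sigma>" "v \<in> ?T p" "w \<in> ?T p" for p v w
    using assms(2) that by (simp add: isotropic_def)
  have vel: "conj_transpose (A s) *v (A' s *v X p + a' s) = cnj (det (A s)) *s (B *v X p + b)"
    if "s \<in> I" for s p
    by (rule conj_transpose_velocity[OF assms(11,12)[OF that]])
  have "immersed_submanifold_with_boundary CARD('n) ?N ?F"
    unfolding immersed_submanifold_with_boundary_def
  proof (intro conjI ballI)
    show "Hausdorff_space ?N"
      using assms(1)
      by (simp add: Hausdorff_space_prod_topology Hausdorff_space_subtopology immersed_submanifold_def)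
    show "second_countable ?N"
      using assms(1)
      by (simp add: second_countable_prod_topology second_countable_subtopology second_countable_euclidean
          immersed_submanifold_def)
    show "\<exists>V U \<phi>. local_param CARD('n) ?N ?F V U \<phi> \<and> z \<in> \<phi> ` U" if "z \<in> topspace ?N" for z
      using chart that by (cases z) auto
  qed
  moreover have "isotropic CARD('n) ?N ?F"
    unfolding isotropic_def
  proof (intro ballI)
    fix z x y assume z: "z \<in> topspace ?N"
      and xy: "x \<in> tangent_space CARD('n) ?N ?F z" "y \<in> tangent_space CARD('n) ?N ?F z"
    obtain s p where sp: "z = (s, p)" "s \<in> I" "p \<in> topspace \<Sigma>" using z by (cases z) auto
    show "kaehler_form x y = 0"
    proof (rule kaehler_form_add_line)
      show "x \<in> {v + r *\<^sub>R (A' s *v X p + a' s) | v r. v \<in> (*v) (A s) ` ?T p}"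
        "y \<in> {v + r *\<^sub>R (A' s *v X p + a' s) | v r. v \<in> (*v) (A s) ` ?T p}"
        using xy unfolding sp(1) tan[OF sp(2,3)] .
      show "herm v (A' s *v X p + a' s) = 0" if "v \<in> (*v) (A s) ` ?T p" for v
        using that matrix_image_hermitian_direction[OF vel[OF sp(2)]] Tw[OF sp(3)] by auto
      show "kaehler_form v w = 0" if vw: "v \<in> (*v) (A s) ` ?T p" "w \<in> (*v) (A s) ` ?T p" for v w
      proof -
        obtain v' w' where v: "v' \<in> ?T p" "v = A s *v v'" and w: "w' \<in> ?T p" "w = A s *v w'"
          using vw by blast
        show ?thesis
          unfolding v(2) w(2)
          by (rule kaehler_form_preserved[OF assms(5,6) sp(2) assms(9,11)
                initial_data_symmetric[OF ini sp(3) v(1) w(1)] assms(13) iso0[OF sp(3) v(1) w(1)]])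
      qed
    qed
  qed
  moreover have "lagrangian_angle (tangent_space CARD('n) ?N ?F z) = \<Theta>" if z: "z \<in> topspace ?N" for z
  proof -
    obtain s p where sp: "z = (s, p)" "s \<in> I" "p \<in> topspace \<Sigma>" using z by (cases z) auto
    note T = tangent_space_subspace_dim[OF assms(1) sp(3)]
    show ?thesis
      unfolding sp(1) tan[OF sp(2,3)]
      \<comment> \<open>The angle at \<open>(s, p)\<close> equals that of the initial data at
        \<open>p\<close>, so the constant of the initial data serves for all times.\<close>
      using lagrangian_angle_transport[OF T iso0[OF sp(3)] Tw[OF sp(3)] nz[OF sp(3)] assms(8)[OF sp(2)]
          vel[OF sp(2)]] \<Theta>[OF sp(3)] by simp
  qed
  ultimately show ?thesis
    unfolding special_lagrangian_def lagrangian_def by blast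
qed

end
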